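(* Let $\pmb k$ be a field. If $d=2c$ is an even integer and $w\in\pmb k[\pmb z]$ is the determinant of the $3c\times3c$ matrix $A^{(c-1)}$ defined in the context, then $\mathbb A_d\setminus\operatorname{Bal}_d$ is the closed subset $\{\pmb g\in\mathbb A_d\mid\lambda_{\pmb g}\in V(w)\}$ of $\mathbb A_d$.
   Context: $B=\pmb k[x,y]$ is the standard graded polynomial ring with degree $d$ component $B_d$; $\mathbb A_d=B_d\times B_d\times B_d$. If $\pmb g=(g_1,g_2,g_3)\in\mathbb A_d$ with $g_j=\sum_{i=0}^d\lambda_{i,j}x^iy^{d-i}$, then $\lambda_{\pmb g}=(\lambda_{i,j})\in\mathbb A^{3d+3}$ (coordinates $0\le i\le d$, $1\le j\le3$); this identifies $\mathbb A_d$ with affine space $\mathbb A^{3d+3}$, whose coordinate ring is $\pmb k[\pmb z]=\pmb k[\{z_{i,j}\mid0\le i\le d,1\le j\le3\}]$. $\operatorname{Bal}_d$ is the set of $\pmb g\in\mathbb A_d$ such that every entry in a homogeneous Hilbert-Burch matrix for the row vector $[g_1,g_2,g_3]$ has degree $d/2=c$; that is, $I_{\pmb g}=(g_1,g_2,g_3)B$ has height two and there is an exact sequence $0\to B(-3c)^2\xrightarrow{\varphi}B(-2c)^3\xrightarrow{[g_1,g_2,g_3]}B$ with the entries of the $3\times 2$ matrix $\varphi$ homogeneous of degree $c$. $A^{(c-1)}=[A_1\,|\,A_2\,|\,A_3]$, where for $j=1,2,3$ the block $A_j$ is the $3c\times c$ matrix, with rows indexed by $r=0,\dots,3c-1$ and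 columns indexed by $k=0,\dots,c-1$, whose $(r,k)$ entry is $z_{r-k,j}$ (interpreted as $0$ unless $0\le r-k\le d$). *)

theory Defs
  imports
    "HOL-Algebra.Ideal"
    "HOL-Library.Extended_Nat"
    "HOL-Library.FuncSet"
    "HOL-Library.Poly_Mapping"
    "HOL-Computational_Algebra.Polynomial"
    "Jordan_Normal_Form.Determinant"
    "Jordan_Normal_Form.VS_Connect"
begin

subsection \<open>Heights of ideals\<close>

text \<open>A chain of primes \<open>C 0 \<subset> \<dots> \<subset> C n = P\<close> has length \<open>n\<close>. The unit ideal gets
  height \<open>\<infinity>\<close>, as the infimum of the empty set.\<close>

definition prime_height :: "('a, 'b) ring_scheme \<Rightarrow> 'a set \<Rightarrow> enat" where
  "prime_height R P = (SUP n \<in> {n. \<exists>C :: nat \<Rightarrow> 'a set.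
      (\<forall>i\<le>n. primeideal (C i) R) \<and> (\<forall>i<n. C i \<subset> C (Suc i)) \<and> C n = P}. enat n)"

definition ideal_height :: "('a, 'b) ring_scheme \<Rightarrow> 'a set \<Rightarrow> enat" where
  "ideal_height R I = (INF P \<in> {P. primeideal P R \<and> I \<subseteq> P}. prime_height R P)"


subsection \<open>Binary forms\<close>

text \<open>\<open>k[x,y]\<close> is realised as \<open>k[x][y]\<close>: \<open>y\<close> is the outer variable, and the coefficient
  of \<open>x\<^sup>i y\<^sup>j\<close> in \<open>f\<close> is \<open>coeff (coeff f j) i\<close>.\<close>

definition coeff_xy :: "'a::zero poly poly \<Rightarrow> nat \<Rightarrow> nat \<Rightarrow> 'a" where
  "coeff_xy f i j = coeff (coeff f j) i"

definition forms :: "nat \<Rightarrow> 'a::zero poly poly set" where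
  "forms d = {f. \<forall>i j. coeff_xy f i j \<noteq> 0 \<longrightarrow> i + j = d}"

type_synonym 'a triple = "'a poly poly \<times> 'a poly poly \<times> 'a poly poly"

definition triples :: "nat \<Rightarrow> 'a::zero triple set" where
  "triples d = forms d \<times> forms d \<times> forms d"

fun entries :: "'a triple \<Rightarrow> 'a poly poly list" where
  "entries (g1, g2, g3) = [g1, g2, g3]"

definition triple_ideal :: "'a::field triple \<Rightarrow> 'a poly poly set" where
  "triple_ideal g = genideal class_ring (set (entries g))"

text \<open>Exactness of \<open>0 \<rightarrow> B(-3c)\<^sup>2 \<rightarrow> B(-2c)\<^sup>3 \<rightarrow> B\<close> for the maps given by \<open>\<phi>\<close> and by the row
  vector \<open>g\<close>. The twists amount to the entries of \<open>\<phi>\<close> being forms of degree \<open>c\<close> (zero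
  allowed) when those of \<open>g\<close> are forms of degree \<open>2c\<close>.\<close>

definition hilbert_burch_exact :: "'a::field triple \<Rightarrow> 'a poly poly mat \<Rightarrow> bool" where
  "hilbert_burch_exact g \<phi> \<longleftrightarrow>
     (\<forall>u \<in> carrier_vec 2. \<phi> *\<^sub>v u = 0\<^sub>v 3 \<longrightarrow> u = 0\<^sub>v 2) \<and>
     {v \<in> carrier_vec 3. vec_of_list (entries g) \<bullet> v = 0} = (\<lambda>u. \<phi> *\<^sub>v u) ` carrier_vec 2"

text \<open>Meant for even \<open>d\<close> only.\<close>

definition Bal :: "nat \<Rightarrow> 'a::field triple set" where
  "Bal d = {g \<in> triples d.
     ideal_height class_ring (triple_ideal g) = 2 \<and>
     (\<exists>\<phi> \<in> carrier_mat 3 2.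
        (\<forall>r<3. \<forall>s<2. \<phi> $$ (r, s) \<in> forms (d div 2)) \<and> hilbert_burch_exact g \<phi>)}"


subsection \<open>The parameter space of triples of forms\<close>

definition z_index :: "nat \<Rightarrow> (nat \<times> nat) set" where
  "z_index d = {0..d} \<times> {1..3}"

definition affine_space :: "nat \<Rightarrow> (nat \<times> nat \<Rightarrow> 'a) set" where
  "affine_space d = z_index d \<rightarrow>\<^sub>E UNIV"

definition coeff_vector :: "nat \<Rightarrow> 'a::zero triple \<Rightarrow> nat \<times> nat \<Rightarrow> 'a" where
  "coeff_vector d g = (\<lambda>(i, j) \<in> z_index d. coeff_xy (entries g ! (j - 1)) i (d - i))"

text \<open>The type has variables \<open>z\<^sub>i\<^sub>j\<close> for all pairs of natural numbers; \<open>z_polys d\<close> is the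
  subring \<open>k[z]\<close> in the variables with index in \<open>z_index d\<close>.\<close>

type_synonym 'a z_poly = "(nat \<times> nat \<Rightarrow>\<^sub>0 nat) \<Rightarrow>\<^sub>0 'a"

definition z_polys :: "nat \<Rightarrow> 'a::zero z_poly set" where
  "z_polys d = {f. \<forall>m \<in> Poly_Mapping.keys f. Poly_Mapping.keys m \<subseteq> z_index d}"

definition z_var :: "nat \<Rightarrow> nat \<Rightarrow> 'a::zero_neq_one z_poly" where
  "z_var i j = Poly_Mapping.single (Poly_Mapping.single (i, j) 1) 1"

definition eval_z :: "'a::comm_semiring_1 z_poly \<Rightarrow> (nat \<times> nat \<Rightarrow> 'a) \<Rightarrow> 'a" where
  "eval_z f a = (\<Sum>m \<in> Poly_Mapping.keys f. Poly_Mapping.lookup f m * (\<Prod>v \<in> Poly_Mapping.keys m. a v ^ Poly_Mapping.lookup m v))"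

definition zero_locus :: "nat \<Rightarrow> 'a::comm_semiring_1 z_poly set \<Rightarrow> (nat \<times> nat \<Rightarrow> 'a) set" where
  "zero_locus d F = {a \<in> affine_space d. \<forall>f \<in> F. eval_z f a = 0}"

text \<open>Closed in the Zariski topology carried over from affine space along \<open>coeff_vector d\<close>.\<close>

definition closed_in_triples :: "nat \<Rightarrow> 'a::field triple set \<Rightarrow> bool" where
  "closed_in_triples d S \<longleftrightarrow>
     (\<exists>F \<subseteq> z_polys d. S = {g \<in> triples d. coeff_vector d g \<in> zero_locus d F})"


subsection \<open>The block matrix\<close>

definition A_block :: "nat \<Rightarrow> nat \<Rightarrow> 'a::zero_neq_one z_poly mat" where
  "A_block c j = mat (3 * c) c
     (\<lambda>(r, k). if k \<le> r \<and> r - k \<le> 2 * c then z_var (r - k) j else 0)"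

definition A_matrix :: "nat \<Rightarrow> 'a::zero_neq_one z_poly mat" where
  "A_matrix c = mat_of_cols (3 * c) (cols (A_block c 1) @ cols (A_block c 2) @ cols (A_block c 3))"

end

theory Submission
  imports Defs
begin

text \<open>Fix a triple \<open>g\<close> of forms of degree \<open>2c\<close> and consider the linear map that sends three forms
  \<open>q\<^sub>1, q\<^sub>2, q\<^sub>3\<close> of degree \<open>c - 1\<close> to \<open>g\<^sub>1q\<^sub>1 + g\<^sub>2q\<^sub>2 + g\<^sub>3q\<^sub>3\<close>, a form of degree \<open>3c - 1\<close>. Source and
  target both have dimension \<open>3c\<close>, and in the monomial bases the matrix of the map is \<open>A\<close> evaluated
  at the coefficients of \<open>g\<close> (\<open>eval_det_A_matrix\<close>). Hence \<open>w\<close> vanishes at \<open>g\<close> exactly if \<open>g\<close> has a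
  nonzero syzygy of degree \<open>c - 1\<close>, and otherwise the map is bijective. It remains to see that
  \<open>g\<close> is balanced exactly if the map is bijective.

  One direction is a degree count: in the balanced case every syzygy is a combination of the two
  columns of \<open>\<phi>\<close>, whose entries have degree \<open>c\<close>, so there is none of degree \<open>c - 1\<close>
  (\<open>det_nonzero_if_Bal\<close>).

  For the other direction (\<open>Bal_if_det_nonzero\<close>) everything is read off from the bijectivity.
  Surjectivity says that the ideal contains all forms of degree \<open>3c - 1\<close>, among them powers of \<open>x\<close> and
  of \<open>y\<close>. Every prime above the ideal therefore contains \<open>x\<close> and \<open>y\<close>, and has
  height at least two; no prime has greater height, because any three polynomials in two variables
  are algebraically dependent (\<open>prime_chain_length_le_two\<close>). The syzygies are found by reduction modulo \<open>x\<close>. Let \<open>\<gamma>\<close> be the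
  vector of the coefficients of \<open>y\<^sup>2\<^sup>c\<close> in \<open>g\<close>. It is nonzero, and a syzygy restricted to \<open>x = 0\<close> is
  orthogonal to it. Surjectivity lifts each of the two basis vectors of the orthogonal complement
  of \<open>\<gamma>\<close> to a syzygy of degree \<open>c\<close>. From an arbitrary homogeneous syzygy one can subtract
  multiples of these two so that the rest is divisible by \<open>x\<close>; dividing by \<open>x\<close> lowers the degree, and
  in degrees below \<open>c\<close> injectivity leaves nothing (\<open>syzygies_generated_by_two\<close>). That the two
  generators are linearly independent over the polynomial ring follows from the Koszul syzygies,
  which would otherwise be proportional (\<open>generators_independent\<close>).

  Homogeneous computations are carried out after setting \<open>y = 1\<close>: forms of degree \<open>n\<close> then become
  univariate polynomials of degree at most \<open>n\<close>, and division by \<open>x\<close> becomes the removal of a constant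
  coefficient.\<close>

section \<open>Binary forms\<close>

lemma coeff_xy_zero [simp]: "coeff_xy 0 i j = 0"
  and coeff_xy_add [simp]: "coeff_xy (f + g) i j = coeff_xy f i j + coeff_xy g i j"
  for f g :: "'a::comm_monoid_add poly poly"
  by (simp_all add: coeff_xy_def)

lemma coeff_xy_sum: "coeff_xy (\<Sum>x\<in>S. f x) i j = (\<Sum>x\<in>S. coeff_xy (f x) i j)"
  by (simp add: coeff_xy_def coeff_sum)

lemma coeff_xy_eqI: "(\<And>i j. coeff_xy f i j = coeff_xy g i j) \<Longrightarrow> f = g"
  by (simp add: coeff_xy_def poly_eq_iff)

lemma coeff_xy_mult:
  fixes f g :: "'a::comm_semiring_0 poly poly"
  shows "coeff_xy (f * g) i j = (\<Sum>b\<le>j. \<Sum>a\<le>i. coeff_xy f a b * coeff_xy g (i - a) (j - b))"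
  by (simp add: coeff_xy_def coeff_mult coeff_sum)

lemma coeff_xy_mult_nonzeroE:
  fixes f g :: "'a::comm_semiring_0 poly poly"
  assumes "coeff_xy (f * g) i j \<noteq> 0"
  obtains a b where "a \<le> i" "b \<le> j" "coeff_xy f a b \<noteq> 0" "coeff_xy g (i - a) (j - b) \<noteq> 0"
proof -
  obtain a b where "a \<le> i" "b \<le> j" "coeff_xy f a b * coeff_xy g (i - a) (j - b) \<noteq> 0"
    using assms unfolding coeff_xy_mult by (metis (no_types, lifting) atMost_iff sum.neutral)
  then show thesis
    using that[of a b] by (auto dest: mult_not_zero)
qed

text \<open>Bounding both exponents by one number gives a finite box of monomials; this is used for the
  decomposition into components and for the dimension count behind algebraic dependence.\<close>

lemma finitely_many_coeff_xy: "\<exists>N. \<forall>i j. coeff_xy f i j \<noteq> 0 \<longrightarrow> i \<le> N \<and> j \<le> N"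
proof (intro exI[of _ "degree f + (\<Sum>j\<le>degree f. degree (coeff f j))"] allI impI)
  fix i j assume nz: "coeff_xy f i j \<noteq> 0"
  then have "coeff f j \<noteq> 0" and i: "i \<le> degree (coeff f j)"
    by (auto simp: coeff_xy_def intro: le_degree)
  then have j: "j \<le> degree f"
    by (auto intro: le_degree)
  have "degree (coeff f j) \<le> (\<Sum>j\<le>degree f. degree (coeff f j))"
    using j by (intro member_le_sum) auto
  with i j show "i \<le> degree f + (\<Sum>j\<le>degree f. degree (coeff f j)) \<and>
      j \<le> degree f + (\<Sum>j\<le>degree f. degree (coeff f j))"
    by linarith
qed

definition binary_form :: "nat \<Rightarrow> (nat \<Rightarrow> 'a) \<Rightarrow> 'a::comm_monoid_add poly poly" where
  "binary_form n a = (\<Sum>i\<le>n. monom (monom (a i) i) (n - i))"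

lemma coeff_xy_binary_form: "coeff_xy (binary_form n a) i j = (if i + j = n then a i else 0)"
proof -
  have "coeff_xy (binary_form n a) i j = (\<Sum>i'\<le>n. if i' = i \<and> i + j = n then a i else 0)"
    by (auto simp: binary_form_def coeff_xy_def coeff_sum intro!: sum.cong)
  then show ?thesis
    by auto
qed

lemma binary_form_in_forms: "binary_form n a \<in> forms n"
  by (auto simp: forms_def coeff_xy_binary_form split: if_splits)

lemma form_eq_binary_form: "f \<in> forms n \<Longrightarrow> f = binary_form n (\<lambda>i. coeff_xy f i (n - i))"
  by (rule coeff_xy_eqI) (auto simp: forms_def coeff_xy_binary_form)

lemma zero_in_forms: "0 \<in> forms n"
  by (simp add: forms_def)

lemma add_in_forms: "f \<in> forms n \<Longrightarrow> g \<in> forms n \<Longrightarrow> f + g \<in> forms n"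
  for f g :: "'a::comm_monoid_add poly poly"
  by (force simp: forms_def)

lemma sum_in_forms: "(\<And>x. x \<in> S \<Longrightarrow> f x \<in> forms n) \<Longrightarrow> (\<Sum>x\<in>S. f x) \<in> forms n"
  by (induction S rule: infinite_finite_induct) (auto simp: zero_in_forms add_in_forms)

lemma mult_in_forms:
  fixes f g :: "'a::comm_semiring_0 poly poly"
  assumes "f \<in> forms m" "g \<in> forms n"
  shows "f * g \<in> forms (m + n)"
proof -
  have "i + j = m + n" if nz: "coeff_xy (f * g) i j \<noteq> 0" for i j
  proof -
    obtain a b where ab: "a \<le> i" "b \<le> j" "coeff_xy f a b \<noteq> 0" "coeff_xy g (i - a) (j - b) \<noteq> 0"
      using nz by (rule coeff_xy_mult_nonzeroE)
    then have "a + b = m" "i - a + (j - b) = n"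
      using assms by (auto simp only: forms_def)
    with ab show ?thesis
      by linarith
  qed
  then show ?thesis
    by (simp add: forms_def)
qed

lemma coeff_dehomogenization:
  fixes f :: "'a::comm_semiring_1 poly poly"
  assumes "f \<in> forms n"
  shows "coeff (poly f 1) i = (if i \<le> n then coeff_xy f i (n - i) else 0)"
proof -
  have "poly f 1 = (\<Sum>i\<le>n. monom (coeff_xy f i (n - i)) i)"
    by (subst form_eq_binary_form[OF assms]) (simp add: binary_form_def poly_sum poly_monom)
  then show ?thesis
    by (simp add: coeff_sum)
qed

lemma degree_dehomogenization: "f \<in> forms n \<Longrightarrow> degree (poly f 1) \<le> n"
  for f :: "'a::comm_semiring_1 poly poly"
  by (rule degree_le) (simp add: coeff_dehomogenization)

text \<open>On forms of a fixed degree, setting \<open>y = 1\<close> loses no information. Identities between forms can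
  therefore be checked on univariate polynomials.\<close>

lemma form_eqI:
  fixes f g :: "'a::comm_semiring_1 poly poly"
  assumes "f \<in> forms n" "g \<in> forms n" "poly f 1 = poly g 1"
  shows "f = g"
proof -
  have "coeff_xy f i (n - i) = coeff_xy g i (n - i)" if "i \<le> n" for i
    using arg_cong[OF assms(3), of "\<lambda>p. coeff p i"] that
    by (simp add: coeff_dehomogenization[OF assms(1)] coeff_dehomogenization[OF assms(2)])
  then have "binary_form n (\<lambda>i. coeff_xy f i (n - i)) = binary_form n (\<lambda>i. coeff_xy g i (n - i))"
    by (simp add: binary_form_def)
  then show ?thesis
    using form_eq_binary_form[OF assms(1)] form_eq_binary_form[OF assms(2)] by simp
qed

lemma dehomogenization_homogenization:
  fixes P :: "'a::comm_semiring_1 poly"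
  assumes "degree P \<le> n"
  shows "poly (binary_form n (coeff P)) 1 = P"
  using assms by (intro poly_eqI)
    (auto simp: coeff_dehomogenization[OF binary_form_in_forms] coeff_xy_binary_form coeff_eq_0)

definition component :: "nat \<Rightarrow> 'a::comm_monoid_add poly poly \<Rightarrow> 'a poly poly" where
  "component e f = binary_form e (\<lambda>i. coeff_xy f i (e - i))"

lemma coeff_xy_component: "coeff_xy (component e f) i j = (if i + j = e then coeff_xy f i j else 0)"
  by (auto simp: component_def coeff_xy_binary_form)

lemma component_in_forms: "component e f \<in> forms e"
  by (simp add: component_def binary_form_in_forms)

lemma component_zero [simp]: "component e 0 = 0"
  by (rule coeff_xy_eqI) (simp add: coeff_xy_component)

lemma component_add: "component e (f + g) = component e f + component e g"
  by (rule coeff_xy_eqI) (simp add: coeff_xy_component)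

lemma component_sum: "component e (\<Sum>x\<in>S. f x) = (\<Sum>x\<in>S. component e (f x))"
  by (induction S rule: infinite_finite_induct) (auto simp: component_add)

lemma component_self: "f \<in> forms e \<Longrightarrow> component e f = f"
  by (simp add: component_def flip: form_eq_binary_form)

text \<open>Multiplication by a form is homogeneous, so the components of a syzygy of forms are
  themselves syzygies.\<close>

lemma component_form_mult:
  fixes f g :: "'a::comm_semiring_0 poly poly"
  assumes "g \<in> forms n"
  shows "component (n + e) (g * f) = g * component e f"
proof (rule coeff_xy_eqI)
  fix i j
  show "coeff_xy (component (n + e) (g * f)) i j = coeff_xy (g * component e f) i j"
  proof (cases "i + j = n + e")
    case True
    have "coeff_xy g a b * coeff_xy f (i - a) (j - b) =
        coeff_xy g a b * coeff_xy (component e f) (i - a) (j - b)" if "a \<le> i" "b \<le> j" for a b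
    proof (cases "a + b = n")
      case False
      then have "coeff_xy g a b = 0"
        using assms by (auto simp: forms_def)
      then show ?thesis
        by simp
    next
      case True
      then have "i - a + (j - b) = e"
        using that \<open>i + j = n + e\<close> by linarith
      then show ?thesis
        by (simp add: coeff_xy_component)
    qed
    then show ?thesis
      using True by (simp add: coeff_xy_component coeff_xy_mult)
  next
    case False
    then show ?thesis
      using mult_in_forms[OF assms component_in_forms[of e f]]
      by (auto simp: coeff_xy_component forms_def)
  qed
qed

lemma component_form_mult_below:
  fixes f g :: "'a::comm_semiring_0 poly poly"
  assumes "g \<in> forms n" "e < n"
  shows "component e (g * f) = 0"
proof (rule coeff_xy_eqI)
  fix i j
  have "coeff_xy g a b = 0" if "a \<le> i" "b \<le> j" "i + j = e" for a b
    using that assms by (force simp: forms_def)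
  then show "coeff_xy (component e (g * f)) i j = coeff_xy 0 i j"
    by (simp add: coeff_xy_component coeff_xy_mult)
qed

lemma sum_components: "\<exists>N. \<forall>M\<ge>N. (\<Sum>e<M. component e f) = f"
proof -
  obtain N where N: "\<And>i j. coeff_xy f i j \<noteq> 0 \<Longrightarrow> i \<le> N \<and> j \<le> N"
    using finitely_many_coeff_xy by metis
  have "(\<Sum>e<M. component e f) = f" if "M \<ge> 2 * N + 1" for M
  proof (rule coeff_xy_eqI)
    fix i j
    show "coeff_xy (\<Sum>e<M. component e f) i j = coeff_xy f i j"
      using N[of i j] that by (cases "coeff_xy f i j = 0") (auto simp: coeff_xy_sum coeff_xy_component)
  qed
  then show ?thesis
    by blast
qed

lemma entries_in_forms: "g \<in> triples d \<Longrightarrow> j < 3 \<Longrightarrow> entries g ! j \<in> forms d"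
  by (cases g) (auto simp: triples_def numeral_3_eq_3 less_Suc_eq)

section \<open>Syzygies of three binary forms\<close>

lemma orthogonal_complement_spanned_by_two:
  fixes \<gamma> :: "nat \<Rightarrow> 'a::field"
  assumes "\<exists>j<3. \<gamma> j \<noteq> 0"
  obtains p r where "(\<Sum>j<3. \<gamma> j * p j) = 0" "(\<Sum>j<3. \<gamma> j * r j) = 0"
    "\<forall>v. (\<Sum>j<3. \<gamma> j * v j) = 0 \<longrightarrow> (\<exists>a b. \<forall>j<3. v j = a * p j + b * r j)"
proof -
  note result = that
  have pivot: thesis if three: "{..<3} = {i, j, k}" and distinct: "i \<noteq> j" "i \<noteq> k" "j \<noteq> k"
    and nz: "\<gamma> i \<noteq> 0" for i j k :: nat
  proof -
    have sum3: "(\<Sum>t<3. f t) = f i + f j + f k" for f :: "nat \<Rightarrow> 'a"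
      unfolding three using distinct by simp
    have all3: "(\<forall>t<3. A t) \<longleftrightarrow> A i \<and> A j \<and> A k" for A :: "nat \<Rightarrow> bool"
      using three by (metis insert_iff lessThan_iff singletonD)
    define p where "p t = (if t = i then \<gamma> j else if t = j then - \<gamma> i else 0)" for t
    define r where "r t = (if t = i then \<gamma> k else if t = k then - \<gamma> i else 0)" for t
    have "\<exists>a b. \<forall>t<3. v t = a * p t + b * r t" if v: "(\<Sum>t<3. \<gamma> t * v t) = 0" for v
    proof -
      have "v i = - (v j * \<gamma> j + v k * \<gamma> k) / \<gamma> i"
        using v nz by (simp add: sum3 field_simps eq_neg_iff_add_eq_0)
      then show ?thesis
        using distinct nz
        by (intro exI[of _ "- v j / \<gamma> i"] exI[of _ "- v k / \<gamma> i"])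
          (simp add: all3 p_def r_def field_simps)
    qed
    then show thesis
      using result[of p r] distinct by (simp add: sum3 p_def r_def algebra_simps)
  qed
  have three: "{..<3} = {0, 1, 2 :: nat}" "{..<3} = {1, 0, 2 :: nat}" "{..<3} = {2, 0, 1 :: nat}"
    by auto
  consider "\<gamma> 0 \<noteq> 0" | "\<gamma> 1 \<noteq> 0" | "\<gamma> 2 \<noteq> 0"
    using assms three(1) by (metis insertE lessThan_iff singletonD)
  then show thesis
    by cases (use pivot[OF three(1)] pivot[OF three(2)] pivot[OF three(3)] in simp_all)
qed

text \<open>The map \<open>Q \<mapsto> G\<^sub>0Q\<^sub>0 + G\<^sub>1Q\<^sub>1 + G\<^sub>2Q\<^sub>2\<close> on triples of polynomials of degree below \<open>c\<close> takes its
  values in degree below \<open>3c\<close>. The locale expresses that it is a bijection between these spaces;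
  its two halves are what the structure of the syzygies rests on.\<close>

locale bijective_multiplication =
  fixes c :: nat and G :: "nat \<Rightarrow> 'a::field poly"
  assumes c_pos: "c \<ge> 1"
    and degree_G: "j < 3 \<Longrightarrow> degree (G j) \<le> 2 * c"
    and inj: "\<lbrakk>\<And>j. j < 3 \<Longrightarrow> degree (Q j) \<le> c - 1; (\<Sum>j<3. G j * Q j) = 0; j < 3\<rbrakk> \<Longrightarrow> Q j = 0"
    and surj: "degree H \<le> 3 * c - 1 \<Longrightarrow>
      \<exists>Q. (\<forall>j<3. degree (Q j) \<le> c - 1) \<and> (\<Sum>j<3. G j * Q j) = H"
begin

text \<open>If \<open>x\<close> divided all three polynomials, then \<open>1\<close> would not be in the image.\<close>

lemma constant_terms_not_all_zero: "\<exists>j<3. coeff (G j) 0 \<noteq> 0"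
proof (rule ccontr)
  assume "\<not> ?thesis"
  then have zero: "coeff (G j) 0 = 0" if "j < 3" for j
    using that by auto
  obtain Q where "(\<Sum>j<3. G j * Q j) = 1"
    using surj[of 1] by auto
  moreover have "coeff (\<Sum>j<3. G j * Q j) 0 = 0"
    by (simp add: coeff_sum coeff_mult_0 zero)
  ultimately show False
    by simp
qed

text \<open>The combination \<open>\<Sum> G\<^sub>j v\<^sub>j\<close> has constant term zero, so it is \<open>x H\<close>. Writing \<open>H = \<Sum> G\<^sub>j U\<^sub>j\<close> by
  surjectivity, \<open>v\<^sub>j - x U\<^sub>j\<close> is a syzygy. This is the point where the generators of degree \<open>c\<close>
  come from.\<close>

lemma syzygy_with_constant_terms:
  assumes "(\<Sum>j<3. coeff (G j) 0 * v j) = 0"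
  obtains P where "\<forall>j<3. degree (P j) \<le> c" "\<forall>j<3. coeff (P j) 0 = v j"
    "(\<Sum>j<3. G j * P j) = 0"
proof -
  let ?F = "\<Sum>j<3. G j * [:v j:]"
  obtain a H where aH: "?F = pCons a H"
    by (rule pCons_cases)
  have "coeff ?F 0 = 0"
    using assms by (simp add: coeff_sum coeff_mult_0 mult.commute)
  then have F: "?F = pCons 0 H"
    using aH by simp
  have "degree ?F \<le> 2 * c"
  proof (rule degree_sum_le)
    fix j :: nat assume "j \<in> {..<3}"
    then show "degree (G j * [:v j:]) \<le> 2 * c"
      using degree_G[of j] degree_mult_le[of "G j" "[:v j:]"] by simp
  qed simp
  then have "degree H \<le> 3 * c - 1"
    using F c_pos by (cases "H = 0") auto
  then obtain U where U: "\<And>j. j < 3 \<Longrightarrow> degree (U j) \<le> c - 1" "(\<Sum>j<3. G j * U j) = H"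
    using surj by blast
  show thesis
  proof (rule that[of "\<lambda>j. [:v j:] - pCons 0 (U j)"]; (intro allI impI)?)
    fix j :: nat assume "j < 3"
    then have "degree (pCons 0 (U j)) \<le> c"
      using U(1)[of j] c_pos by (cases "U j = 0") auto
    then show "degree ([:v j:] - pCons 0 (U j)) \<le> c"
      by (intro degree_diff_le) auto
  next
    have "(\<Sum>j<3. G j * pCons 0 (U j)) = pCons 0 1 * (\<Sum>j<3. G j * U j)"
      by (simp add: sum_distrib_left)
    then show "(\<Sum>j<3. G j * ([:v j:] - pCons 0 (U j))) = 0"
      using F U(2) by (simp only: right_diff_distrib sum_subtractf) simp
  qed simp
qed

text \<open>The degree bounds on \<open>\<alpha>\<close> and \<open>\<beta>\<close> say that the relation is homogeneous when the polynomials are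
  turned back into forms; an unbounded relation would not suffice for that.\<close>

lemma syzygies_generated_by_two:
  obtains P R where "\<forall>j<3. degree (P j) \<le> c" "\<forall>j<3. degree (R j) \<le> c"
    "(\<Sum>j<3. G j * P j) = 0" "(\<Sum>j<3. G j * R j) = 0"
    "\<forall>Q e. (\<forall>j<3. degree (Q j) \<le> e) \<and> (\<Sum>j<3. G j * Q j) = 0 \<longrightarrow>
       (\<exists>\<alpha> \<beta>. (\<forall>j<3. Q j = \<alpha> * P j + \<beta> * R j) \<and>
             (\<alpha> \<noteq> 0 \<longrightarrow> degree \<alpha> + c \<le> e) \<and> (\<beta> \<noteq> 0 \<longrightarrow> degree \<beta> + c \<le> e))"
proof -
  obtain p r where p: "(\<Sum>j<3. coeff (G j) 0 * p j) = 0" and r: "(\<Sum>j<3. coeff (G j) 0 * r j) = 0"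
    and span: "\<forall>v. (\<Sum>j<3. coeff (G j) 0 * v j) = 0 \<longrightarrow> (\<exists>a b. \<forall>j<3. v j = a * p j + b * r j)"
    by (rule orthogonal_complement_spanned_by_two[OF constant_terms_not_all_zero])
  obtain P where P: "\<forall>j<3. degree (P j) \<le> c" "\<forall>j<3. coeff (P j) 0 = p j"
    "(\<Sum>j<3. G j * P j) = 0"
    by (rule syzygy_with_constant_terms[OF p])
  obtain R where R: "\<forall>j<3. degree (R j) \<le> c" "\<forall>j<3. coeff (R j) 0 = r j"
    "(\<Sum>j<3. G j * R j) = 0"
    by (rule syzygy_with_constant_terms[OF r])
  have gen: "\<exists>\<alpha> \<beta>. (\<forall>j<3. Q j = \<alpha> * P j + \<beta> * R j) \<and>
             (\<alpha> \<noteq> 0 \<longrightarrow> degree \<alpha> + c \<le> e) \<and> (\<beta> \<noteq> 0 \<longrightarrow> degree \<beta> + c \<le> e)"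
    if "\<And>j. j < 3 \<Longrightarrow> degree (Q j) \<le> e" "(\<Sum>j<3. G j * Q j) = 0" for Q e
    using that
  proof (induction e arbitrary: Q)
    case (0 Q)
    have "Q j = 0" if "j < 3" for j
      using inj[of Q] 0 that by auto
    then show ?case
      by (intro exI[of _ 0]) auto
  next
    case (Suc e Q)
    show ?case
    proof (cases "c \<le> Suc e")
      case False
      have "Q j = 0" if "j < 3" for j
      proof (rule inj[of Q])
        show "degree (Q i) \<le> c - 1" if "i < 3" for i
          using Suc.prems(1)[OF that] False by linarith
      qed (use Suc.prems that in auto)
      then show ?thesis
        by (intro exI[of _ 0]) auto
    next
      case True
      \<comment> \<open>Match the constant terms first; what is left is divisible by \<open>x\<close>.\<close>
      have "(\<Sum>j<3. coeff (G j) 0 * coeff (Q j) 0) = coeff (\<Sum>j<3. G j * Q j) 0"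
        by (simp add: coeff_sum coeff_mult_0)
      then obtain a b where ab: "\<And>j. j < 3 \<Longrightarrow> coeff (Q j) 0 = a * p j + b * r j"
        using span[rule_format, of "\<lambda>j. coeff (Q j) 0"] Suc.prems(2) by auto
      define D where "D j = Q j - [:a:] * P j - [:b:] * R j" for j
      define Q' where "Q' j = (THE q. D j = pCons 0 q)" for j
      have D: "D j = pCons 0 (Q' j)" if "j < 3" for j
      proof -
        have "coeff (D j) 0 = 0"
          using ab[OF that] P(2)[rule_format, OF that] R(2)[rule_format, OF that] by (simp add: D_def coeff_mult_0)
        then obtain q where "D j = pCons 0 q"
          by (metis pCons_cases coeff_pCons_0)
        then show ?thesis
          unfolding Q'_def by simp
      qed
      have deg: "degree (Q' j) \<le> e" if "j < 3" for j
      proof -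
        have "degree ([:a:] * P j) \<le> Suc e" "degree ([:b:] * R j) \<le> Suc e"
          using P(1)[rule_format, OF that] R(1)[rule_format, OF that] True degree_smult_le[of a "P j"] degree_smult_le[of b "R j"]
          by auto
        then have "degree (D j) \<le> Suc e"
          unfolding D_def using Suc.prems(1)[OF that] by (intro degree_diff_le) auto
        then show ?thesis
          using D[OF that] by (cases "Q' j = 0") auto
      qed
      have "(\<Sum>j<3. G j * D j) = (\<Sum>j<3. G j * Q j) - [:a:] * (\<Sum>j<3. G j * P j) - [:b:] * (\<Sum>j<3. G j * R j)"
        by (simp only: D_def right_diff_distrib sum_subtractf sum_distrib_left mult.left_commute)
      then have "(\<Sum>j<3. G j * pCons 0 (Q' j)) = 0"
        using Suc.prems(2) P(3) R(3) D by simp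
      moreover have "(\<Sum>j<3. G j * pCons 0 (Q' j)) = pCons 0 1 * (\<Sum>j<3. G j * Q' j)"
        by (simp add: sum_distrib_left)
      ultimately have "(\<Sum>j<3. G j * Q' j) = 0"
        by simp
      then obtain \<alpha> \<beta> where *: "\<And>j. j < 3 \<Longrightarrow> Q' j = \<alpha> * P j + \<beta> * R j"
        "\<alpha> \<noteq> 0 \<longrightarrow> degree \<alpha> + c \<le> e" "\<beta> \<noteq> 0 \<longrightarrow> degree \<beta> + c \<le> e"
        using Suc.IH[of Q'] deg by blast
      have "Q j = pCons a \<alpha> * P j + pCons b \<beta> * R j" if "j < 3" for j
      proof -
        have "Q j = [:a:] * P j + [:b:] * R j + pCons 0 (Q' j)"
          using D[OF that] by (simp add: D_def algebra_simps)
        then show ?thesis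
          using *(1)[OF that] by (simp add: algebra_simps)
      qed
      moreover have "degree (pCons a \<alpha>) + c \<le> Suc e" "degree (pCons b \<beta>) + c \<le> Suc e"
        using *(2,3) True by auto
      ultimately show ?thesis
        by blast
    qed
  qed
  show thesis
    using that[of P R] P R gen by blast
qed

end

text \<open>Homogeneous syzygies correspond to univariate ones with a degree bound, and a general syzygy is
  the sum of its homogeneous components, so the univariate result carries over to all of \<open>k[x,y]\<close>.\<close>

lemma two_generators_of_syzygy_module:
  fixes g :: "nat \<Rightarrow> 'a::field poly poly"
  assumes g: "\<And>j. j < 3 \<Longrightarrow> g j \<in> forms (2 * c)"
    and bij: "bijective_multiplication c (\<lambda>j. poly (g j) 1)"
  obtains p r where "\<forall>j<3. p j \<in> forms c" "\<forall>j<3. r j \<in> forms c"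
    "(\<Sum>j<3. g j * p j) = 0" "(\<Sum>j<3. g j * r j) = 0"
    "\<forall>v. (\<Sum>j<3. g j * v j) = 0 \<longrightarrow> (\<exists>a b. \<forall>j<3. v j = p j * a + r j * b)"
proof -
  interpret bijective_multiplication c "\<lambda>j. poly (g j) 1"
    by (fact bij)
  obtain P R where P: "\<forall>j<3. degree (P j) \<le> c" and R: "\<forall>j<3. degree (R j) \<le> c"
    and syz: "(\<Sum>j<3. poly (g j) 1 * P j) = 0" "(\<Sum>j<3. poly (g j) 1 * R j) = 0"
    and gen: "\<forall>Q e. (\<forall>j<3. degree (Q j) \<le> e) \<and> (\<Sum>j<3. poly (g j) 1 * Q j) = 0 \<longrightarrow>
       (\<exists>\<alpha> \<beta>. (\<forall>j<3. Q j = \<alpha> * P j + \<beta> * R j) \<and>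
             (\<alpha> \<noteq> 0 \<longrightarrow> degree \<alpha> + c \<le> e) \<and> (\<beta> \<noteq> 0 \<longrightarrow> degree \<beta> + c \<le> e))"
    by (rule syzygies_generated_by_two)
  define p r where "p j = binary_form c (coeff (P j))" and "r j = binary_form c (coeff (R j))" for j
  have p: "p j \<in> forms c" and r: "r j \<in> forms c" for j
    by (simp_all add: p_def r_def binary_form_in_forms)
  have p1: "poly (p j) 1 = P j" and r1: "poly (r j) 1 = R j" if "j < 3" for j
    using that P R by (simp_all add: p_def r_def dehomogenization_homogenization)
  have gp: "(\<Sum>j<3. g j * p j) = 0" "(\<Sum>j<3. g j * r j) = 0"
    using syz p1 r1 g p r
    by (auto intro!: form_eqI[of _ "2 * c + c"] sum_in_forms mult_in_forms zero_in_forms simp: poly_sum)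
  have homogeneous: "\<exists>a b. \<forall>j<3. u j = p j * a + r j * b"
    if u: "\<And>j. j < 3 \<Longrightarrow> u j \<in> forms e" and gu: "(\<Sum>j<3. g j * u j) = 0" for u e
  proof -
    have "(\<Sum>j<3. poly (g j) 1 * poly (u j) 1) = poly (\<Sum>j<3. g j * u j) 1"
      by (simp add: poly_sum)
    then obtain \<alpha> \<beta> where ab: "\<And>j. j < 3 \<Longrightarrow> poly (u j) 1 = \<alpha> * P j + \<beta> * R j"
      and \<alpha>: "\<alpha> \<noteq> 0 \<longrightarrow> degree \<alpha> + c \<le> e" and \<beta>: "\<beta> \<noteq> 0 \<longrightarrow> degree \<beta> + c \<le> e"
      using gen[rule_format, of "\<lambda>j. poly (u j) 1" e] degree_dehomogenization[OF u] gu by auto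
    define a b where "a = binary_form (e - c) (coeff \<alpha>)" and "b = binary_form (e - c) (coeff \<beta>)"
    have a1: "poly a 1 = \<alpha>" and b1: "poly b 1 = \<beta>"
      using \<alpha> \<beta> unfolding a_def b_def
      by (cases "\<alpha> = 0"; cases "\<beta> = 0"; intro dehomogenization_homogenization; simp)+
    have "u j = p j * a + r j * b" if j: "j < 3" for j
    proof (rule form_eqI[of _ e])
      show "p j * a + r j * b \<in> forms e"
      proof (cases "c \<le> e")
        case True
        then have "p j * a \<in> forms e" "r j * b \<in> forms e"
          using mult_in_forms[of "p j" c a "e - c"] mult_in_forms[of "r j" c b "e - c"] p r
          by (simp_all add: a_def b_def binary_form_in_forms)
        then show ?thesis
          by (rule add_in_forms)
      next
        case False
        then have "\<alpha> = 0" "\<beta> = 0"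
          using \<alpha> \<beta> by auto
        then show ?thesis
          by (simp add: a_def b_def binary_form_def zero_in_forms)
      qed
    qed (use ab j u p1 r1 a1 b1 in \<open>simp_all add: mult.commute\<close>)
    then show ?thesis
      by blast
  qed
  have "\<exists>a b. \<forall>j<3. v j = p j * a + r j * b" if gv: "(\<Sum>j<3. g j * v j) = 0" for v
  proof -
    have "\<exists>a b. \<forall>j<3. component e (v j) = p j * a + r j * b" for e
    proof (rule homogeneous)
      have "(\<Sum>j<3. g j * component e (v j)) = (\<Sum>j<3. component (2 * c + e) (g j * v j))"
        using g by (intro sum.cong) (simp_all add: component_form_mult)
      also have "\<dots> = component (2 * c + e) (\<Sum>j<3. g j * v j)"
        by (simp add: component_sum)
      finally show "(\<Sum>j<3. g j * component e (v j)) = 0"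
        using gv by simp
    qed (rule component_in_forms)
    then obtain a b where ab: "\<And>e j. j < 3 \<Longrightarrow> component e (v j) = p j * a e + r j * b e"
      by metis
    have "\<forall>j. \<exists>N. \<forall>M\<ge>N. (\<Sum>e<M. component e (v j)) = v j"
      using sum_components by blast
    then obtain N where N: "\<And>j M. N j \<le> M \<Longrightarrow> (\<Sum>e<M. component e (v j)) = v j"
      unfolding choice_iff by blast
    define M where "M = (\<Sum>j<3. N j)"
    have "v j = p j * (\<Sum>e<M. a e) + r j * (\<Sum>e<M. b e)" if "j < 3" for j
    proof -
      have "N j \<le> M"
        unfolding M_def using that by (intro member_le_sum) auto
      then have "v j = (\<Sum>e<M. p j * a e + r j * b e)"
        using N[of j M] ab[OF that] by simp
      then show ?thesis
        by (simp add: sum.distrib sum_distrib_left)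
    qed
    then show ?thesis
      by blast
  qed
  then show thesis
    using that[of p r] p r gp by blast
qed

text \<open>The syzygies \<open>(g\<^sub>1, -g\<^sub>0, 0)\<close> and \<open>(g\<^sub>2, 0, -g\<^sub>0)\<close> are combinations of \<open>p\<close> and \<open>r\<close>. Their minor in the
  last two coordinates is \<open>g\<^sub>0\<^sup>2\<close>, and by multiplicativity of the determinant it is a multiple of the corresponding minor
  of \<open>p\<close> and \<open>r\<close>.\<close>

lemma koszul_determinant:
  fixes g p r :: "nat \<Rightarrow> 'a::comm_ring_1"
  assumes gen: "\<forall>v. (\<Sum>j<3. g j * v j) = 0 \<longrightarrow> (\<exists>a b. \<forall>j<3. v j = p j * a + r j * b)"
  shows "\<exists>t. g 0 * g 0 = t * (p 1 * r 2 - p 2 * r 1)"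
proof -
  have sum3: "(\<Sum>j<3. f j) = f 0 + f 1 + f 2" for f :: "nat \<Rightarrow> 'a"
    by (simp add: numeral_3_eq_3 numeral_2_eq_2)
  obtain a b where "\<forall>j<3. (if j = 0 then g 1 else if j = 1 then - g 0 else 0) = p j * a + r j * b"
    using gen[rule_format, of "\<lambda>j. if j = 0 then g 1 else if j = 1 then - g 0 else 0"]
    by (auto simp: sum3)
  from this[rule_format, of 1] this[rule_format, of 2]
  have 1: "- g 0 = p 1 * a + r 1 * b" "0 = p 2 * a + r 2 * b"
    by simp_all
  obtain a' b' where "\<forall>j<3. (if j = 0 then g 2 else if j = 2 then - g 0 else 0) = p j * a' + r j * b'"
    using gen[rule_format, of "\<lambda>j. if j = 0 then g 2 else if j = 2 then - g 0 else 0"]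
    by (auto simp: sum3)
  from this[rule_format, of 1] this[rule_format, of 2]
  have 2: "0 = p 1 * a' + r 1 * b'" "- g 0 = p 2 * a' + r 2 * b'"
    by simp_all
  have "g 0 * g 0 = (- g 0) * (- g 0) - 0 * 0"
    by simp
  also have "\<dots> = (p 1 * a + r 1 * b) * (p 2 * a' + r 2 * b') - (p 2 * a + r 2 * b) * (p 1 * a' + r 1 * b')"
    using 1 2 by metis
  also have "\<dots> = (a * b' - b * a') * (p 1 * r 2 - p 2 * r 1)"
    by (simp add: algebra_simps)
  finally show ?thesis
    by blast
qed

text \<open>A relation between \<open>p\<close> and \<open>r\<close> makes their minors, multiplied by \<open>a\<close> or \<open>b\<close>, vanish; the minor
  in the last two coordinates is nonzero because it divides \<open>g\<^sub>0\<^sup>2\<close>.\<close>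

lemma generators_independent:
  fixes g p r :: "nat \<Rightarrow> 'a::idom"
  assumes gen: "\<forall>v. (\<Sum>j<3. g j * v j) = 0 \<longrightarrow> (\<exists>a b. \<forall>j<3. v j = p j * a + r j * b)"
    and "g 0 \<noteq> 0" and zero: "\<And>j. j < 3 \<Longrightarrow> p j * a + r j * b = 0"
  shows "a = 0 \<and> b = 0"
proof -
  have nz: "p 1 * r 2 - p 2 * r 1 \<noteq> 0"
    using koszul_determinant[OF gen] \<open>g 0 \<noteq> 0\<close> by auto
  have 1: "p 1 * a + r 1 * b = 0" and 2: "p 2 * a + r 2 * b = 0"
    using zero[of 1] zero[of 2] by simp_all
  have "a * (p 1 * r 2 - p 2 * r 1) = (p 1 * a + r 1 * b) * r 2 - (p 2 * a + r 2 * b) * r 1"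
    by (simp add: algebra_simps)
  moreover have "b * (p 1 * r 2 - p 2 * r 1) = (p 2 * a + r 2 * b) * p 1 - (p 1 * a + r 1 * b) * p 2"
    by (simp add: algebra_simps)
  ultimately show ?thesis
    using nz unfolding 1 2 by simp
qed

section \<open>Prime ideals of a commutative ring\<close>

lemma ideal_class_ring_iff:
  "ideal I (class_ring :: 'r::comm_ring_1 ring) \<longleftrightarrow>
     0 \<in> I \<and> (\<forall>a\<in>I. \<forall>b\<in>I. a + b \<in> I) \<and> (\<forall>a\<in>I. \<forall>x. x * a \<in> I)"
proof
  assume "ideal I (class_ring :: 'r ring)"
  then interpret I: ideal I "class_ring :: 'r ring" .
  show "0 \<in> I \<and> (\<forall>a\<in>I. \<forall>b\<in>I. a + b \<in> I) \<and> (\<forall>a\<in>I. \<forall>x. x * a \<in> I)"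
    using I.zero_closed I.a_closed I.I_l_closed by auto
next
  assume *: "0 \<in> I \<and> (\<forall>a\<in>I. \<forall>b\<in>I. a + b \<in> I) \<and> (\<forall>a\<in>I. \<forall>x. x * a \<in> I)"
  have "group (add_monoid (class_ring :: 'r ring))"
    by (intro abelian_group.a_group ring.is_abelian_group class_ring.ring_axioms)
  then have "subgroup I (add_monoid (class_ring :: 'r ring))"
  proof (rule group.subgroupI)
    fix a assume "a \<in> I"
    then have "(-1) * a \<in> I"
      using * by blast
    then show "inv\<^bsub>add_monoid class_ring\<^esub> a \<in> I"
      unfolding a_inv_def[symmetric] by (simp add: class_ring_simps)
  qed (use * in auto)
  then show "ideal I (class_ring :: 'r ring)"
    by (rule idealI[OF class_ring.ring_axioms]) (use * in \<open>auto simp: mult.commute\<close>)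
qed

lemma primeideal_class_ring_iff:
  "primeideal P (class_ring :: 'r::comm_ring_1 ring) \<longleftrightarrow>
     ideal P (class_ring :: 'r ring) \<and> 1 \<notin> P \<and> (\<forall>a b. a * b \<in> P \<longrightarrow> a \<in> P \<or> b \<in> P)"
proof
  assume "primeideal P (class_ring :: 'r ring)"
  then interpret P: primeideal P "class_ring :: 'r ring" .
  show "ideal P (class_ring :: 'r ring) \<and> 1 \<notin> P \<and> (\<forall>a b. a * b \<in> P \<longrightarrow> a \<in> P \<or> b \<in> P)"
    using P.ideal_axioms P.I_notcarr P.I_prime P.one_imp_carrier by auto
next
  assume *: "ideal P (class_ring :: 'r ring) \<and> 1 \<notin> P \<and> (\<forall>a b. a * b \<in> P \<longrightarrow> a \<in> P \<or> b \<in> P)"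
  show "primeideal P (class_ring :: 'r ring)"
    by (rule primeidealI) (use * class_cring.cring_axioms in auto)
qed

lemma primeideal_powerD:
  assumes P: "primeideal P (class_ring :: 'r::comm_ring_1 ring)" and "x ^ n \<in> P"
  shows "x \<in> P"
  using \<open>x ^ n \<in> P\<close>
proof (induction n)
  case 0
  then show ?case
    using P by (simp add: primeideal_class_ring_iff)
next
  case (Suc n)
  then show ?case
    using P by (auto simp: primeideal_class_ring_iff)
qed

lemma sum_mult_in_triple_ideal:
  "(\<Sum>j<3. entries g ! j * q j) \<in> triple_ideal g" for g :: "'a::field triple"
proof -
  obtain g1 g2 g3 where g: "g = (g1, g2, g3)"
    by (cases g)
  have id: "ideal (triple_ideal g) class_ring"
    unfolding triple_ideal_def by (rule ring.genideal_ideal[OF class_ring.ring_axioms]) simp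
  have "set (entries g) \<subseteq> triple_ideal g"
    unfolding triple_ideal_def by (rule ring.genideal_self[OF class_ring.ring_axioms]) simp
  then have "g1 * q 0 \<in> triple_ideal g" "g2 * q 1 \<in> triple_ideal g" "g3 * q 2 \<in> triple_ideal g"
    using id by (auto simp: g ideal_class_ring_iff mult.commute)
  then have "g1 * q 0 + g2 * q 1 + g3 * q 2 \<in> triple_ideal g"
    using id by (auto simp: ideal_class_ring_iff)
  then show ?thesis
    by (simp add: g numeral_3_eq_3 numeral_2_eq_2)
qed

section \<open>Heights of primes in the polynomial ring in two variables\<close>

text \<open>Gaussian elimination: each equation costs at most one unknown, namely a pivot \<open>p\<close> that is
  removed from \<open>I\<close> and whose value \<open>t\<close> is recovered at the end.\<close>

lemma homogeneous_linear_system: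
  fixes A :: "'i \<Rightarrow> 'j \<Rightarrow> 'a::field"
  assumes "finite J" "finite I" "card J < card I"
  shows "\<exists>l. (\<exists>i\<in>I. l i \<noteq> 0) \<and> (\<forall>j\<in>J. (\<Sum>i\<in>I. l i * A i j) = 0)"
  using assms
proof (induction J arbitrary: I A rule: finite_induct)
  case empty
  then have "I \<noteq> {}"
    by auto
  then show ?case
    by (auto intro!: exI[of _ "\<lambda>_. 1"])
next
  case (insert j J)
  show ?case
  proof (cases "\<exists>i\<in>I. A i j \<noteq> 0")
    case False
    then show ?thesis
      using insert by (auto dest!: insert.IH[of I A])
  next
    case True
    then obtain p where p: "p \<in> I" "A p j \<noteq> 0"
      by blast
    define B where "B i k = A i k - A i j / A p j * A p k" for i k
    have "card J < card (I - {p})"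
      using insert.prems insert.hyps p by simp
    then obtain l where l: "\<exists>i\<in>I - {p}. l i \<noteq> 0" "\<And>k. k \<in> J \<Longrightarrow> (\<Sum>i\<in>I - {p}. l i * B i k) = 0"
      using insert.IH[of "I - {p}" B] insert.prems by auto
    define t where "t = - (\<Sum>i\<in>I - {p}. l i * A i j) / A p j"
    have split: "(\<Sum>i\<in>I. (l(p := t)) i * A i k) = t * A p k + (\<Sum>i\<in>I - {p}. l i * A i k)" for k
      using p insert.prems by (subst sum.remove[of I p]) (auto intro!: sum.cong)
    have "(\<Sum>i\<in>I - {p}. l i * B i k) = t * A p k + (\<Sum>i\<in>I - {p}. l i * A i k)" for k
      by (simp add: B_def t_def right_diff_distrib sum_subtractf sum_divide_distrib sum_distrib_right mult.assoc)
    then have "(\<Sum>i\<in>I. (l(p := t)) i * A i k) = 0" if "k \<in> J" for k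
      using l(2)[OF that] split by simp
    moreover have "(\<Sum>i\<in>I. (l(p := t)) i * A i j) = 0"
      unfolding split using p(2) by (simp add: t_def)
    moreover have "\<exists>i\<in>I. (l(p := t)) i \<noteq> 0"
      using l(1) by auto
    ultimately show ?thesis
      by blast
  qed
qed

definition bounded_degrees :: "nat \<Rightarrow> 'a::zero poly poly \<Rightarrow> bool" where
  "bounded_degrees D f \<longleftrightarrow> (\<forall>i j. coeff_xy f i j \<noteq> 0 \<longrightarrow> i \<le> D \<and> j \<le> D)"

lemma bounded_degrees_mono: "bounded_degrees D f \<Longrightarrow> D \<le> E \<Longrightarrow> bounded_degrees E f"
  by (force simp: bounded_degrees_def)

lemma bounded_degrees_mult:
  fixes f g :: "'a::comm_semiring_0 poly poly"
  assumes "bounded_degrees D f" "bounded_degrees E g"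
  shows "bounded_degrees (D + E) (f * g)"
  unfolding bounded_degrees_def
proof (intro allI impI)
  fix i j assume nz: "coeff_xy (f * g) i j \<noteq> 0"
  obtain a b where ab: "a \<le> i" "b \<le> j" "coeff_xy f a b \<noteq> 0" "coeff_xy g (i - a) (j - b) \<noteq> 0"
    using nz by (rule coeff_xy_mult_nonzeroE)
  then have "a \<le> D" "b \<le> D" "i - a \<le> E" "j - b \<le> E"
    using assms by (auto simp only: bounded_degrees_def)
  with ab show "i \<le> D + E \<and> j \<le> D + E"
    by linarith
qed

lemma bounded_degrees_power:
  fixes f :: "'a::comm_semiring_1 poly poly"
  assumes "bounded_degrees D f"
  shows "bounded_degrees (n * D) (f ^ n)"
proof (induction n)
  case 0
  show ?case
    by (auto simp: bounded_degrees_def coeff_xy_def split: if_splits)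
next
  case (Suc n)
  then show ?case
    using bounded_degrees_mult[OF assms Suc.IH] by simp
qed

text \<open>There are \<open>N\<^sup>3\<close> monomials in \<open>x, y, z\<close> with exponents below \<open>N\<close>, while their values lie in a space of
  polynomials in two variables whose dimension grows only like \<open>N\<^sup>2\<close>.\<close>

lemma algebraic_dependence_of_three:
  fixes x y z :: "'a::field poly poly"
  obtains N l where "\<exists>a<N. \<exists>b<N. \<exists>c<N. l a b c \<noteq> 0"
    "(\<Sum>a<N. (\<Sum>b<N. (\<Sum>c<N. [:[:l a b c:]:] * z ^ c) * y ^ b) * x ^ a) = 0"
proof -
  have "\<exists>D. bounded_degrees D f" for f :: "'a poly poly"
    unfolding bounded_degrees_def by (rule finitely_many_coeff_xy)
  then obtain Dx Dy Dz where "bounded_degrees Dx x" "bounded_degrees Dy y" "bounded_degrees Dz z"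
    by metis
  then obtain D where D: "bounded_degrees D x" "bounded_degrees D y" "bounded_degrees D z"
    using bounded_degrees_mono[of Dx x "Dx + Dy + Dz"] bounded_degrees_mono[of Dy y "Dx + Dy + Dz"]
      bounded_degrees_mono[of Dz z "Dx + Dy + Dz"] by auto
  \<comment> \<open>All monomials have degree at most \<open>3ND\<close> in each variable, and with this \<open>N\<close> one has
    \<open>(3ND + 1)\<^sup>2 < N\<^sup>3\<close>.\<close>
  define N where "N = Suc ((3 * D + 1)\<^sup>2)"
  define I where "I = {..<N} \<times> {..<N} \<times> {..<N}"
  define J where "J = {..3 * N * D} \<times> {..3 * N * D}"
  define m where "m = (\<lambda>(a, b, c). z ^ c * y ^ b * x ^ a)"
  have bounded: "bounded_degrees (3 * N * D) (m t)" if "t \<in> I" for t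
  proof -
    obtain a b c where t: "t = (a, b, c)"
      by (cases t)
    have "a \<le> N" "b \<le> N" "c \<le> N"
      using that by (auto simp: I_def t)
    then have "c * D + b * D + a * D \<le> 3 * N * D"
      using mult_le_mono1[of a N D] mult_le_mono1[of b N D] mult_le_mono1[of c N D] by linarith
    moreover have "bounded_degrees (c * D + b * D + a * D) (m t)"
      unfolding t m_def using D by (auto intro!: bounded_degrees_mult bounded_degrees_power)
    ultimately show ?thesis
      using bounded_degrees_mono by blast
  qed
  have "1 \<le> N"
    by (simp add: N_def)
  then have "3 * N * D + 1 \<le> N * (3 * D + 1)"
    by (simp add: algebra_simps)
  then have "(3 * N * D + 1) * (3 * N * D + 1) \<le> (N * (3 * D + 1)) * (N * (3 * D + 1))"
    by (intro mult_le_mono)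
  also have "\<dots> = N * N * (3 * D + 1)\<^sup>2"
    by (simp add: power2_eq_square algebra_simps)
  also have "\<dots> < N * N * N"
    unfolding N_def by simp
  finally have "card J < card I"
    by (simp add: I_def J_def card_cartesian_product)
  then obtain l where l: "\<exists>t\<in>I. l t \<noteq> 0"
    and eq: "\<And>s. s \<in> J \<Longrightarrow> (\<Sum>t\<in>I. l t * (case s of (i, j) \<Rightarrow> coeff_xy (m t) i j)) = 0"
    using homogeneous_linear_system[of J I "\<lambda>t (i, j). coeff_xy (m t) i j"]
    by (auto simp: I_def J_def)
  have "(\<Sum>t\<in>I. [:[:l t:]:] * m t) = 0"
  proof (rule coeff_xy_eqI)
    fix i j
    have "coeff_xy (\<Sum>t\<in>I. [:[:l t:]:] * m t) i j = (\<Sum>t\<in>I. l t * coeff_xy (m t) i j)"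
      by (simp add: coeff_xy_sum) (simp add: coeff_xy_def)
    also have "\<dots> = 0"
    proof (cases "(i, j) \<in> J")
      case True
      then show ?thesis
        using eq[of "(i, j)"] by simp
    next
      case False
      then have "coeff_xy (m t) i j = 0" if "t \<in> I" for t
        using bounded[OF that] by (auto simp: bounded_degrees_def J_def)
      then show ?thesis
        by simp
    qed
    finally show "coeff_xy (\<Sum>t\<in>I. [:[:l t:]:] * m t) i j = coeff_xy 0 i j"
      by simp
  qed
  moreover have "(\<Sum>t\<in>I. [:[:l t:]:] * m t) =
      (\<Sum>a<N. \<Sum>b<N. \<Sum>c<N. [:[:l (a, b, c):]:] * (z ^ c * y ^ b * x ^ a))"
    unfolding I_def m_def by (simp add: sum.cartesian_product case_prod_beta del: mult_pCons_left)
  ultimately have "(\<Sum>a<N. (\<Sum>b<N. (\<Sum>c<N. [:[:l (a, b, c):]:] * z ^ c) * y ^ b) * x ^ a) = 0"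
    by (simp add: sum_distrib_right mult.assoc del: mult_pCons_left)
  moreover have "\<exists>a<N. \<exists>b<N. \<exists>c<N. l (a, b, c) \<noteq> 0"
    using l by (force simp: I_def)
  ultimately show thesis
    using that[of N "\<lambda>a b c. l (a, b, c)"] by blast
qed

text \<open>This is the engine for bounding the length of prime chains. If \<open>m\<close> is the least index with
  \<open>f m \<noteq> 0\<close>, the sum is \<open>x\<^sup>m (f m + x s)\<close>. If it were in \<open>P\<close>, then so would be \<open>f m + x s\<close>, because
  \<open>x \<notin> P\<close>; but then \<open>x \<in> P'\<close> puts \<open>f m\<close> into \<open>P'\<close>.\<close>

lemma power_sum_notin_smaller_prime:
  fixes f :: "nat \<Rightarrow> 'r::comm_ring_1"
  assumes P: "primeideal P class_ring" and P': "primeideal P' class_ring" and "P \<subseteq> P'"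
    and x: "x \<in> P'" "x \<notin> P"
    and f: "\<And>i. i < n \<Longrightarrow> f i = 0 \<or> f i \<notin> P'" and "\<exists>i<n. f i \<noteq> 0"
  shows "(\<Sum>i<n. f i * x ^ i) \<notin> P"
  using f \<open>\<exists>i<n. f i \<noteq> 0\<close>
proof (induction n arbitrary: f)
  case 0
  then show ?case
    by simp
next
  case (Suc n)
  define s where "s = (\<Sum>i<n. f (Suc i) * x ^ i)"
  have split: "(\<Sum>i<Suc n. f i * x ^ i) = f 0 + x * s"
    by (simp add: s_def sum.lessThan_Suc_shift sum_distrib_left mult_ac del: sum.lessThan_Suc)
  show ?case
  proof (cases "f 0 = 0")
    case True
    have "s \<notin> P"
      unfolding s_def
    proof (rule Suc.IH)
      show "\<exists>i<n. f (Suc i) \<noteq> 0"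
        using Suc.prems(2) True by (metis less_Suc_eq_0_disj)
    qed (use Suc.prems(1) in auto)
    then have "x * s \<notin> P"
      using x P by (auto simp: primeideal_class_ring_iff)
    then show ?thesis
      unfolding split using True by simp
  next
    case False
    show ?thesis
    proof
      assume "(\<Sum>i<Suc n. f i * x ^ i) \<in> P"
      then have "f 0 + x * s \<in> P'"
        using split \<open>P \<subseteq> P'\<close> by auto
      moreover have "(- s) * x \<in> P'"
        using x P' by (auto simp only: primeideal_class_ring_iff ideal_class_ring_iff)
      ultimately have "f 0 + x * s + (- s) * x \<in> P'"
        using P' by (simp only: primeideal_class_ring_iff ideal_class_ring_iff)
      then have "f 0 \<in> P'"
        by (simp add: mult.commute)
      then show False
        using Suc.prems(1)[of 0] False by simp
    qed
  qed
qed

text \<open>Choose \<open>x\<close>, \<open>y\<close>, \<open>z\<close> witnessing the three strict inclusions and take a polynomial relation between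
  them. Nonzero constants are outside \<open>C 3\<close>; hence nonzero polynomials in \<open>z\<close> with constant
  coefficients take values outside \<open>C 2\<close>, nonzero polynomials in \<open>y\<close> over these take values
  outside \<open>C 1\<close>, and finally the relation has a value outside \<open>C 0\<close> although it is zero. (This is
  the elementary characterisation of Krull dimension due to Coquand and Lombardi.)\<close>

lemma prime_chain_length_le_two:
  fixes C :: "nat \<Rightarrow> 'a::field poly poly set"
  assumes prime: "\<And>i. i \<le> 3 \<Longrightarrow> primeideal (C i) class_ring"
    and chain: "\<And>i. i < 3 \<Longrightarrow> C i \<subset> C (Suc i)"
  shows False
proof -
  obtain x y z where x: "x \<in> C 1" "x \<notin> C 0" and y: "y \<in> C 2" "y \<notin> C 1" and z: "z \<in> C 3" "z \<notin> C 2"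
    using chain[of 0] chain[of 1] chain[of 2] by (auto simp: numeral_3_eq_3 numeral_2_eq_2)
  have sub: "C 0 \<subseteq> C 1" "C 1 \<subseteq> C 2" "C 2 \<subseteq> C 3"
    using chain[of 0] chain[of 1] chain[of 2] by (auto simp: numeral_3_eq_3 numeral_2_eq_2)
  have pr: "primeideal (C 0) class_ring" "primeideal (C 1) class_ring"
    "primeideal (C 2) class_ring" "primeideal (C 3) class_ring"
    using prime by simp_all
  obtain N l where nz: "\<exists>a<N. \<exists>b<N. \<exists>c<N. l a b c \<noteq> 0"
    and dep: "(\<Sum>a<N. (\<Sum>b<N. (\<Sum>c<N. [:[:l a b c:]:] * z ^ c) * y ^ b) * x ^ a) = 0"
    by (rule algebraic_dependence_of_three)
  define S2 where "S2 a b = (\<Sum>c<N. [:[:l a b c:]:] * z ^ c)" for a b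
  define S1 where "S1 a = (\<Sum>b<N. S2 a b * y ^ b)" for a
  have unit: "[:[:t:]:] \<notin> C 3" if "t \<noteq> 0" for t
  proof
    assume "[:[:t:]:] \<in> C 3"
    then have "[:[:inverse t:]:] * [:[:t:]:] \<in> C 3"
      using pr(4) by (simp only: primeideal_class_ring_iff ideal_class_ring_iff)
    moreover have "[:[:inverse t:]:] * [:[:t:]:] = (1 :: 'a poly poly)"
      using that by (simp add: one_pCons)
    ultimately show False
      using pr(4) by (simp add: primeideal_class_ring_iff)
  qed
  have S2: "S2 a b \<notin> C 2" if "\<exists>c<N. l a b c \<noteq> 0" for a b
    unfolding S2_def using that unit
    by (intro power_sum_notin_smaller_prime[OF pr(3) pr(4) sub(3) z]) auto
  have S2_zero: "S2 a b = 0 \<or> S2 a b \<notin> C 2" for a b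
    using S2[of a b] by (cases "\<exists>c<N. l a b c \<noteq> 0") (auto simp: S2_def)
  have zero_mem: "0 \<in> C i" if "i \<le> 3" for i
    using prime[OF that] by (simp add: primeideal_class_ring_iff ideal_class_ring_iff)
  have S1: "S1 a \<notin> C 1" if "\<exists>b<N. S2 a b \<noteq> 0" for a
    unfolding S1_def using that S2_zero
    by (intro power_sum_notin_smaller_prime[OF pr(2) pr(3) sub(2) y]) auto
  have S1_zero: "S1 a = 0 \<or> S1 a \<notin> C 1" for a
    using S1[of a] by (cases "\<exists>b<N. S2 a b \<noteq> 0") (auto simp: S1_def)
  obtain a b c where abc: "a < N" "b < N" "c < N" "l a b c \<noteq> 0"
    using nz by blast
  have "S2 a b \<notin> C 2"
    using S2 abc by blast
  then have "S2 a b \<noteq> 0"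
    using zero_mem[of 2] by auto
  then have "S1 a \<notin> C 1"
    using S1 abc by blast
  then have "S1 a \<noteq> 0"
    using zero_mem[of 1] by auto
  then have "(\<Sum>a<N. S1 a * x ^ a) \<notin> C 0"
    using S1_zero abc
    by (intro power_sum_notin_smaller_prime[OF pr(1) pr(2) sub(1) x]) auto
  then show False
    using dep zero_mem[of 0] by (simp add: S1_def S2_def)
qed

lemma prime_height_le_two: "prime_height class_ring P \<le> 2"
  for P :: "'a::field poly poly set"
  unfolding prime_height_def
proof (rule SUP_least)
  fix n assume "n \<in> {n. \<exists>C :: nat \<Rightarrow> 'a poly poly set.
      (\<forall>i\<le>n. primeideal (C i) class_ring) \<and> (\<forall>i<n. C i \<subset> C (Suc i)) \<and> C n = P}"
  then obtain C :: "nat \<Rightarrow> 'a poly poly set" where "\<forall>i\<le>n. primeideal (C i) class_ring" "\<forall>i<n. C i \<subset> C (Suc i)"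
    by blast
  note chain = this
  have "n < 3"
  proof (rule ccontr)
    assume "\<not> n < 3"
    then show False
      using chain by (intro prime_chain_length_le_two[of C]) simp_all
  qed
  then have "enat n \<le> enat 2"
    by simp
  then show "enat n \<le> 2"
    by (simp add: numeral_eq_enat)
qed

text \<open>The chain is \<open>0 \<subset> (y) \<subset> P\<close>, where membership in \<open>(y)\<close> means that the coefficient of \<open>y\<^sup>0\<close> vanishes.\<close>

lemma prime_height_ge_two:
  fixes P :: "'a::field poly poly set"
  assumes P: "primeideal P class_ring" and x: "[:[:0, 1:]:] \<in> P" and y: "[:0, 1:] \<in> P"
  shows "prime_height class_ring P \<ge> 2"
proof -
  define Y :: "'a poly poly set" where "Y = {f. coeff f 0 = 0}"
  define C where "C i = (if i = 0 then {0} else if i = 1 then Y else P)" for i :: nat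
  have "primeideal {0 :: 'a poly poly} class_ring" "primeideal Y class_ring"
    by (auto simp: primeideal_class_ring_iff ideal_class_ring_iff Y_def coeff_mult_0)
  then have "\<forall>i\<le>2. primeideal (C i) class_ring"
    using P by (simp add: C_def)
  moreover have "{0} \<subset> Y"
  proof
    show "{0} \<noteq> Y"
      using x by (metis (mono_tags) Y_def coeff_pCons_0 mem_Collect_eq pCons_eq_0_iff singletonD zero_neq_one)
  qed (simp add: Y_def)
  moreover have "Y \<subset> P"
  proof
    show "Y \<subseteq> P"
    proof
      fix f assume "f \<in> Y"
      then obtain h where "f = pCons 0 h"
        by (cases f) (auto simp: Y_def)
      then have "f = h * [:0, 1:]"
        by simp
      then show "f \<in> P"
        using P y by (simp only: primeideal_class_ring_iff ideal_class_ring_iff)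
    qed
    show "Y \<noteq> P"
      using x by (auto simp: Y_def)
  qed
  ultimately have "2 \<in> {n. \<exists>C :: nat \<Rightarrow> 'a poly poly set.
      (\<forall>i\<le>n. primeideal (C i) class_ring) \<and> (\<forall>i<n. C i \<subset> C (Suc i)) \<and> C n = P}"
    by (auto intro!: exI[of _ C] simp: C_def less_2_cases_iff)
  then have "enat 2 \<le> prime_height class_ring P"
    unfolding prime_height_def by (intro SUP_upper)
  then show ?thesis
    by (simp add: numeral_eq_enat)
qed

text \<open>The powers force \<open>x\<close> and \<open>y\<close> into every prime above \<open>I\<close>. The first assumption makes the maximal
  ideal of the origin such a prime; without one the height would be infinite.\<close>

lemma ideal_height_eq_two:
  fixes I :: "'a::field poly poly set"
  assumes origin: "I \<subseteq> {f. coeff_xy f 0 0 = 0}"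
    and powers: "[:[:0, 1:]:] ^ m \<in> I" "[:0, 1:] ^ n \<in> I"
  shows "ideal_height class_ring I = 2"
proof (rule antisym)
  have "primeideal {f :: 'a poly poly. coeff_xy f 0 0 = 0} class_ring"
    by (auto simp: primeideal_class_ring_iff ideal_class_ring_iff coeff_xy_mult) (simp add: coeff_xy_def)
  then have "ideal_height class_ring I \<le> prime_height class_ring {f :: 'a poly poly. coeff_xy f 0 0 = 0}"
    unfolding ideal_height_def using origin by (intro INF_lower) auto
  also have "\<dots> \<le> 2"
    by (rule prime_height_le_two)
  finally show "ideal_height class_ring I \<le> 2" .
  show "2 \<le> ideal_height class_ring I"
    unfolding ideal_height_def
  proof (rule INF_greatest)
    fix P assume "P \<in> {P. primeideal P class_ring \<and> I \<subseteq> P}"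
    then have P: "primeideal P class_ring" "I \<subseteq> P"
      by auto
    have "[:[:0, 1:]:] \<in> P"
      by (rule primeideal_powerD[OF P(1)]) (use powers P(2) in blast)
    moreover have "[:0, 1:] \<in> P"
      by (rule primeideal_powerD[OF P(1)]) (use powers P(2) in blast)
    ultimately show "2 \<le> prime_height class_ring P"
      using P(1) by (intro prime_height_ge_two)
  qed
qed

section \<open>Evaluation of polynomials in the parameters\<close>

definition eval_monomial :: "(nat \<times> nat \<Rightarrow> 'a::comm_semiring_1) \<Rightarrow> (nat \<times> nat \<Rightarrow>\<^sub>0 nat) \<Rightarrow> 'a" where
  "eval_monomial a m = (\<Prod>v \<in> Poly_Mapping.keys m. a v ^ Poly_Mapping.lookup m v)"

lemma eval_monomial_superset:
  assumes "finite S" "Poly_Mapping.keys m \<subseteq> S"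
  shows "eval_monomial a m = (\<Prod>v\<in>S. a v ^ Poly_Mapping.lookup m v)"
  unfolding eval_monomial_def using assms
  by (intro prod.mono_neutral_left) (auto simp: in_keys_iff)

lemma eval_monomial_add: "eval_monomial a (m + n) = eval_monomial a m * eval_monomial a n"
proof -
  let ?S = "Poly_Mapping.keys m \<union> Poly_Mapping.keys n"
  have "eval_monomial a (m + n) = (\<Prod>v\<in>?S. a v ^ Poly_Mapping.lookup (m + n) v)"
    by (rule eval_monomial_superset) (simp_all add: keys_add)
  also have "\<dots> = (\<Prod>v\<in>?S. a v ^ Poly_Mapping.lookup m v) * (\<Prod>v\<in>?S. a v ^ Poly_Mapping.lookup n v)"
    by (simp add: lookup_add power_add prod.distrib)
  also have "\<dots> = eval_monomial a m * eval_monomial a n"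
    using eval_monomial_superset[of ?S m a] eval_monomial_superset[of ?S n a] by simp
  finally show ?thesis .
qed

lemma eval_z_superset:
  assumes "finite S" "Poly_Mapping.keys f \<subseteq> S"
  shows "eval_z f a = (\<Sum>m\<in>S. Poly_Mapping.lookup f m * eval_monomial a m)"
  unfolding eval_z_def eval_monomial_def using assms
  by (intro sum.mono_neutral_left) (auto simp: in_keys_iff)

lemma eval_z_zero: "eval_z 0 a = 0"
  by (simp add: eval_z_def)

lemma eval_z_add: "eval_z (f + g) a = eval_z f a + eval_z g a"
proof -
  let ?S = "Poly_Mapping.keys f \<union> Poly_Mapping.keys g"
  have "eval_z (f + g) a = (\<Sum>m\<in>?S. Poly_Mapping.lookup (f + g) m * eval_monomial a m)"
    by (rule eval_z_superset) (simp_all add: keys_add)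
  then show ?thesis
    using eval_z_superset[of ?S f a] eval_z_superset[of ?S g a]
    by (simp add: lookup_add distrib_right sum.distrib)
qed

lemma eval_z_sum: "eval_z (\<Sum>x\<in>S. f x) a = (\<Sum>x\<in>S. eval_z (f x) a)"
  by (induction S rule: infinite_finite_induct) (simp_all add: eval_z_zero eval_z_add)

lemma eval_z_single: "eval_z (Poly_Mapping.single m t) a = t * eval_monomial a m"
  by (cases "t = 0") (simp_all add: eval_z_zero eval_z_superset[of "{m}"])

lemma sum_of_monomials:
  "f = (\<Sum>m\<in>Poly_Mapping.keys f. Poly_Mapping.single m (Poly_Mapping.lookup f m))"
  by (rule poly_mapping_eqI)
    (auto simp: lookup_sum lookup_single when_def in_keys_iff)

lemma eval_z_mult: "eval_z (f * g) a = eval_z f a * eval_z g a"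
proof -
  let ?K = "Poly_Mapping.keys" and ?l = "Poly_Mapping.lookup" and ?s = "Poly_Mapping.single"
  have "f * g = (\<Sum>m\<in>?K f. ?s m (?l f m)) * (\<Sum>n\<in>?K g. ?s n (?l g n))"
    by (simp flip: sum_of_monomials)
  also have "\<dots> = (\<Sum>m\<in>?K f. \<Sum>n\<in>?K g. ?s (m + n) (?l f m * ?l g n))"
    by (simp add: sum_product mult_single)
  finally have "eval_z (f * g) a =
      (\<Sum>m\<in>?K f. \<Sum>n\<in>?K g. (?l f m * eval_monomial a m) * (?l g n * eval_monomial a n))"
    by (simp add: eval_z_sum eval_z_single eval_monomial_add mult_ac)
  then show ?thesis
    by (simp add: sum_product eval_z_superset[of "?K f" f] eval_z_superset[of "?K g" g])
qed

lemma eval_z_one: "eval_z 1 a = 1"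
  using eval_z_single[of 0 1 a] by (simp add: eval_monomial_def)

lemma eval_z_var: "eval_z (z_var i j) a = a (i, j)"
  by (simp add: z_var_def eval_z_single eval_monomial_def)

lemma eval_z_hom: "comm_ring_hom (\<lambda>f. eval_z f (a :: nat \<times> nat \<Rightarrow> 'a::comm_ring_1))"
  by unfold_locales (simp_all add: eval_z_zero eval_z_one eval_z_add eval_z_mult)

lemma zero_in_z_polys: "0 \<in> z_polys d"
  by (simp add: z_polys_def)

lemma one_in_z_polys: "1 \<in> z_polys d"
  by (simp add: z_polys_def)

lemma uminus_in_z_polys: "f \<in> z_polys d \<Longrightarrow> - f \<in> z_polys d"
  for f :: "'a::comm_ring_1 z_poly"
  by (auto simp: z_polys_def in_keys_iff)

lemma add_in_z_polys: "f \<in> z_polys d \<Longrightarrow> g \<in> z_polys d \<Longrightarrow> f + g \<in> z_polys d"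
  using keys_add[of f g] unfolding z_polys_def by blast

lemma mult_in_z_polys:
  assumes "f \<in> z_polys d" "g \<in> z_polys d"
  shows "f * g \<in> z_polys d"
  unfolding z_polys_def
proof (intro CollectI ballI)
  fix m assume "m \<in> Poly_Mapping.keys (f * g)"
  then obtain a b where "m = a + b" "a \<in> Poly_Mapping.keys f" "b \<in> Poly_Mapping.keys g"
    using keys_mult by blast
  then show "Poly_Mapping.keys m \<subseteq> z_index d"
    using assms keys_add[of a b] unfolding z_polys_def by blast
qed

lemma sum_in_z_polys: "(\<And>x. x \<in> S \<Longrightarrow> f x \<in> z_polys d) \<Longrightarrow> (\<Sum>x\<in>S. f x) \<in> z_polys d"
  by (induction S rule: infinite_finite_induct) (auto simp: zero_in_z_polys add_in_z_polys)

lemma prod_in_z_polys: "(\<And>x. x \<in> S \<Longrightarrow> f x \<in> z_polys d) \<Longrightarrow> (\<Prod>x\<in>S. f x) \<in> z_polys d"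
  by (induction S rule: infinite_finite_induct) (auto simp: one_in_z_polys mult_in_z_polys)

lemma z_var_in_z_polys: "(i, j) \<in> z_index d \<Longrightarrow> z_var i j \<in> z_polys d"
  by (simp add: z_polys_def z_var_def)

lemma det_in_z_polys:
  fixes A :: "'a::comm_ring_1 z_poly mat"
  assumes A: "A \<in> carrier_mat n n" and entries: "\<And>r k. r < n \<Longrightarrow> k < n \<Longrightarrow> A $$ (r, k) \<in> z_polys d"
  shows "det A \<in> z_polys d"
  unfolding det_def'[OF A]
proof (intro sum_in_z_polys mult_in_z_polys prod_in_z_polys)
  fix p assume p: "p \<in> {p. p permutes {0..<n}}"
  show "signof p \<in> (z_polys d :: 'a z_poly set)"
    by (cases p rule: sign_cases) (simp_all add: one_in_z_polys uminus_in_z_polys)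
  fix i assume "i \<in> {0..<n}"
  then show "A $$ (i, p i) \<in> z_polys d"
    using p permutes_in_image[of p "{0..<n}" i] by (intro entries) auto
qed

section \<open>The matrix of multiplication by three polynomials\<close>

definition multiplication_matrix :: "nat \<Rightarrow> (nat \<Rightarrow> 'a::zero poly) \<Rightarrow> 'a mat" where
  "multiplication_matrix c G = mat (3 * c) (3 * c)
     (\<lambda>(r, k). if k mod c \<le> r then coeff (G (k div c)) (r - k mod c) else 0)"

lemma multiplication_matrix_carrier: "multiplication_matrix c G \<in> carrier_mat (3 * c) (3 * c)"
  by (simp add: multiplication_matrix_def)

text \<open>A vector of length \<open>3c\<close> encodes three polynomials of degree below \<open>c\<close>, one in each block of
  \<open>c\<close> consecutive coordinates.\<close>

definition coefficient_block :: "nat \<Rightarrow> 'a::comm_monoid_add vec \<Rightarrow> nat \<Rightarrow> 'a poly" where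
  "coefficient_block c v j = (\<Sum>i<c. monom (v $ (j * c + i)) i)"

lemma coeff_coefficient_block: "coeff (coefficient_block c v j) i = (if i < c then v $ (j * c + i) else 0)"
  by (simp add: coefficient_block_def coeff_sum)

lemma degree_coefficient_block: "degree (coefficient_block c v j) \<le> c - 1"
  by (rule degree_le) (auto simp: coeff_coefficient_block)

lemma block_index_less: "j < 3 \<Longrightarrow> i < c \<Longrightarrow> j * c + i < 3 * c" for c :: nat
  using mult_le_mono1[of "Suc j" 3 c] unfolding mult_Suc by linarith

lemma coefficient_block_vec:
  assumes "c \<ge> 1" "j < 3" "degree (Q j) \<le> c - 1"
  shows "coefficient_block c (vec (3 * c) (\<lambda>k. coeff (Q (k div c)) (k mod c))) j = Q j"
proof (rule poly_eqI)
  fix i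
  show "coeff (coefficient_block c (vec (3 * c) (\<lambda>k. coeff (Q (k div c)) (k mod c))) j) i = coeff (Q j) i"
  proof (cases "i < c")
    case True
    then show ?thesis
      using block_index_less[of j i c] assms by (simp add: coeff_coefficient_block)
  next
    case False
    then show ?thesis
      using assms by (simp add: coeff_coefficient_block coeff_eq_0)
  qed
qed

lemma multiplication_matrix_mult_vec:
  fixes v :: "'a::comm_ring_1 vec"
  assumes v: "v \<in> carrier_vec (3 * c)" and r: "r < 3 * c"
  shows "(multiplication_matrix c G *\<^sub>v v) $ r = coeff (\<Sum>j<3. G j * coefficient_block c v j) r"
proof -
  let ?m = "\<lambda>k. (if k mod c \<le> r then coeff (G (k div c)) (r - k mod c) else 0) * v $ k"
  have "(multiplication_matrix c G *\<^sub>v v) $ r = (\<Sum>k<3 * c. ?m k)"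
    using v r by (auto simp: multiplication_matrix_def scalar_prod_def atLeast0LessThan intro!: sum.cong)
  also have "\<dots> = (\<Sum>j<3. \<Sum>k = j * c..<j * c + c. ?m k)"
    by (rule sum.nat_group[symmetric])
  also have "\<dots> = (\<Sum>j<3. \<Sum>i<c. ?m (j * c + i))"
  proof (rule sum.cong[OF refl])
    fix j :: nat
    show "(\<Sum>k = j * c..<j * c + c. ?m k) = (\<Sum>i<c. ?m (j * c + i))"
      using sum.shift_bounds_nat_ivl[of ?m 0 "j * c" c]
      by (simp only: add_0_left add_0_right atLeast0LessThan add.commute[of _ "j * c"])
  qed
  also have "\<dots> = (\<Sum>j<3. \<Sum>i<c. coeff (G j * monom (v $ (j * c + i)) i) r)"
  proof (intro sum.cong refl)
    fix j i :: nat assume "i \<in> {..<c}"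
    have "coeff (G j * monom t i) r = (if i \<le> r then coeff (G j) (r - i) * t else 0)" for t
      using coeff_monom_mult[of t i "G j" r] by (auto simp: mult.commute not_less)
    then show "?m (j * c + i) = coeff (G j * monom (v $ (j * c + i)) i) r"
      using \<open>i \<in> {..<c}\<close> by simp
  qed
  finally show ?thesis
    by (simp add: coefficient_block_def coeff_sum sum_distrib_left)
qed

lemma degree_sum_products:
  fixes G Q :: "nat \<Rightarrow> 'a::comm_ring_1 poly"
  assumes "c \<ge> 1" "\<And>j. j < 3 \<Longrightarrow> degree (G j) \<le> 2 * c" "\<And>j. j < 3 \<Longrightarrow> degree (Q j) \<le> c - 1"
  shows "degree (\<Sum>j<3. G j * Q j) \<le> 3 * c - 1"
proof (rule degree_sum_le)
  fix j :: nat assume "j \<in> {..<3}"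
  then have "degree (G j) + degree (Q j) \<le> 3 * c - 1"
    using assms(2)[of j] assms(3)[of j] \<open>c \<ge> 1\<close> by auto
  then show "degree (G j * Q j) \<le> 3 * c - 1"
    using degree_mult_le[of "G j" "Q j"] by linarith
qed simp

lemma kernel_if_det_zero:
  fixes G :: "nat \<Rightarrow> 'a::field poly"
  assumes "c \<ge> 1" "\<And>j. j < 3 \<Longrightarrow> degree (G j) \<le> 2 * c" and det: "det (multiplication_matrix c G) = 0"
  obtains Q where "\<forall>j<3. degree (Q j) \<le> c - 1" "(\<Sum>j<3. G j * Q j) = 0" "\<exists>j<3. Q j \<noteq> 0"
proof -
  obtain v where v: "v \<in> carrier_vec (3 * c)" "v \<noteq> 0\<^sub>v (3 * c)"
    and Mv: "multiplication_matrix c G *\<^sub>v v = 0\<^sub>v (3 * c)"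
    using det det_0_iff_vec_prod_zero_field[OF multiplication_matrix_carrier] by blast
  let ?Q = "coefficient_block c v"
  have "(\<Sum>j<3. G j * ?Q j) = 0"
  proof (rule poly_eqI)
    fix r
    show "coeff (\<Sum>j<3. G j * ?Q j) r = coeff 0 r"
    proof (cases "r < 3 * c")
      case True
      then show ?thesis
        using multiplication_matrix_mult_vec[OF v(1) True, of G] Mv by simp
    next
      case False
      moreover have "degree (\<Sum>j<3. G j * ?Q j) \<le> 3 * c - 1"
        using assms by (intro degree_sum_products degree_coefficient_block)
      ultimately show ?thesis
        using \<open>c \<ge> 1\<close> by (simp add: coeff_eq_0)
    qed
  qed
  moreover have "\<exists>j<3. ?Q j \<noteq> 0"
  proof -
    obtain k where k: "k < 3 * c" "v $ k \<noteq> 0"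
      using v by (metis carrier_vecD eq_vecI index_zero_vec)
    have "coeff (?Q (k div c)) (k mod c) = v $ k"
      using \<open>c \<ge> 1\<close> by (simp add: coeff_coefficient_block)
    moreover have "k div c < 3"
      using k(1) \<open>c \<ge> 1\<close> by (simp add: div_less_iff_less_mult)
    ultimately show ?thesis
      using k(2) by (metis coeff_0)
  qed
  ultimately show thesis
    using that[of ?Q] degree_coefficient_block by blast
qed

lemma bijective_if_det_nonzero:
  fixes G :: "nat \<Rightarrow> 'a::field poly"
  assumes c: "c \<ge> 1" and G: "\<And>j. j < 3 \<Longrightarrow> degree (G j) \<le> 2 * c"
    and det: "det (multiplication_matrix c G) \<noteq> 0"
  shows "bijective_multiplication c G"
proof
  let ?M = "multiplication_matrix c G"
  note M = multiplication_matrix_carrier[of c G]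
  fix Q :: "nat \<Rightarrow> 'a poly" and j :: nat
  assume Q: "\<And>j. j < 3 \<Longrightarrow> degree (Q j) \<le> c - 1" and sum: "(\<Sum>j<3. G j * Q j) = 0" and "j < 3"
  define v where "v = vec (3 * c) (\<lambda>k. coeff (Q (k div c)) (k mod c))"
  have v: "v \<in> carrier_vec (3 * c)"
    by (simp add: v_def)
  have block: "coefficient_block c v i = Q i" if "i < 3" for i
    unfolding v_def using c that Q[OF that] by (rule coefficient_block_vec)
  have "?M *\<^sub>v v = 0\<^sub>v (3 * c)"
  proof (rule eq_vecI)
    fix r assume "r < dim_vec (0\<^sub>v (3 * c))"
    then show "(?M *\<^sub>v v) $ r = 0\<^sub>v (3 * c) $ r"
      using multiplication_matrix_mult_vec[OF v, of r G] sum block by simp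
  qed (use M in simp)
  then have "v = 0\<^sub>v (3 * c)"
    using det_0_iff_vec_prod_zero_field[OF M] det v by blast
  show "Q j = 0"
  proof (rule poly_eqI)
    fix i
    have "j * c + i < 3 * c" if "i < c"
      using that \<open>j < 3\<close> by (intro block_index_less)
    then show "coeff (Q j) i = coeff 0 i"
      using \<open>v = 0\<^sub>v (3 * c)\<close> block[OF \<open>j < 3\<close>, symmetric]
      by (simp add: coeff_coefficient_block)
  qed
next
  let ?M = "multiplication_matrix c G"
  note M = multiplication_matrix_carrier[of c G]
  fix H :: "'a poly" assume H: "degree H \<le> 3 * c - 1"
  define h where "h = vec (3 * c) (coeff H)"
  \<comment> \<open>Cramer's rule gives the preimage of \<open>H\<close>.\<close>
  define v where "v = inverse (det ?M) \<cdot>\<^sub>v (adj_mat ?M *\<^sub>v h)"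
  have h: "h \<in> carrier_vec (3 * c)"
    by (simp add: h_def)
  have v: "v \<in> carrier_vec (3 * c)"
    using adj_mat(1)[OF M] h by (simp add: v_def)
  have "?M *\<^sub>v v = inverse (det ?M) \<cdot>\<^sub>v (?M *\<^sub>v (adj_mat ?M *\<^sub>v h))"
    unfolding v_def using M adj_mat(1)[OF M] h by (intro mult_mat_vec) auto
  also have "?M *\<^sub>v (adj_mat ?M *\<^sub>v h) = (?M * adj_mat ?M) *\<^sub>v h"
    using M adj_mat(1)[OF M] h by (simp add: assoc_mult_mat_vec)
  also have "\<dots> = det ?M \<cdot>\<^sub>v h"
    using adj_mat(2)[OF M] h by auto
  finally have Mv: "?M *\<^sub>v v = h"
    using det by (auto simp: smult_smult_assoc)
  have "(\<Sum>j<3. G j * coefficient_block c v j) = H"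
  proof (rule poly_eqI)
    fix r
    show "coeff (\<Sum>j<3. G j * coefficient_block c v j) r = coeff H r"
    proof (cases "r < 3 * c")
      case True
      then show ?thesis
        using multiplication_matrix_mult_vec[OF v True, of G] Mv by (simp add: h_def)
    next
      case False
      moreover have "degree (\<Sum>j<3. G j * coefficient_block c v j) \<le> 3 * c - 1"
        using assms by (intro degree_sum_products degree_coefficient_block)
      ultimately show ?thesis
        using H \<open>c \<ge> 1\<close> by (simp add: coeff_eq_0)
    qed
  qed
  then show "\<exists>Q. (\<forall>j<3. degree (Q j) \<le> c - 1) \<and> (\<Sum>j<3. G j * Q j) = H"
    using degree_coefficient_block by blast
qed (rule c, erule G)

lemma A_matrix_carrier: "A_matrix c \<in> carrier_mat (3 * c) (3 * c)"
  by (rule carrier_matI) (simp_all add: A_matrix_def A_block_def)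

text \<open>Column \<open>k\<close> lies in the block of the form with index \<open>k div c + 1\<close> and is its column number \<open>k mod c\<close>.\<close>

lemma A_matrix_index:
  assumes "r < 3 * c" "k < 3 * c"
  shows "A_matrix c $$ (r, k) =
    (if k mod c \<le> r \<and> r - k mod c \<le> 2 * c then z_var (r - k mod c) (k div c + 1) else 0)"
proof -
  have dims: "dim_row (A_block c j :: 'b::zero_neq_one z_poly mat) = 3 * c"
    "dim_col (A_block c j :: 'b z_poly mat) = c" for j :: nat
    by (simp_all add: A_block_def)
  have col: "col (A_block c j :: 'a z_poly mat) i $ r =
      (if i \<le> r \<and> r - i \<le> 2 * c then z_var (r - i) j else 0)" if "i < c" for i j
    using that assms by (simp add: A_block_def)
  have index: "A_matrix c $$ (r, k) =
      (cols (A_block c 1) @ cols (A_block c 2) @ cols (A_block c 3)) ! k $ r"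
    unfolding A_matrix_def using assms by (intro mat_of_cols_index) (simp_all add: dims)
  consider "k < c" | "c \<le> k" "k < 2 * c" | "2 * c \<le> k"
    by linarith
  then show ?thesis
  proof cases
    case 1
    then show ?thesis
      unfolding index using col by (simp add: nth_append dims)
  next
    case 2
    then have kc: "k - c < c"
      by linarith
    from 2 have "k div c = 1" "k mod c = k - c"
      by (simp_all add: div_nat_eqI mod_nat_eqI)
    then show ?thesis
      unfolding index using col[of "k - c" 2] 2 kc by (simp add: nth_append dims numeral_2_eq_2)
  next
    case 3
    then have kc: "k - 2 * c < c" "\<not> k - c < c" "\<not> k < c"
      using assms by linarith+
    have "k div c = 2"
      by (rule div_nat_eqI) (use 3 assms in simp_all)
    then have "k mod c = k - 2 * c"
      using minus_div_mult_eq_mod[of k c] by simp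
    then show ?thesis
      unfolding index using col[of "k - 2 * c" 3] 3 kc assms \<open>k div c = 2\<close>
      by (simp add: nth_append dims numeral_3_eq_3 numeral_2_eq_2)
  qed
qed

lemma z_index_column: "k < 3 * c \<Longrightarrow> i \<le> 2 * c \<Longrightarrow> (i, Suc (k div c)) \<in> z_index (2 * c)"
  by (cases "c = 0") (auto simp: z_index_def less_mult_imp_div_less less_Suc_eq_le[symmetric])

lemma det_A_matrix_in_z_polys: "det (A_matrix c :: 'a::comm_ring_1 z_poly mat) \<in> z_polys (2 * c)"
  by (rule det_in_z_polys[OF A_matrix_carrier])
    (auto simp: A_matrix_index zero_in_z_polys intro!: z_var_in_z_polys z_index_column)

lemma eval_det_A_matrix:
  fixes g :: "'a::field triple"
  assumes g: "g \<in> triples (2 * c)"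
  shows "eval_z (det (A_matrix c)) (coeff_vector (2 * c) g) =
    det (multiplication_matrix c (\<lambda>j. poly (entries g ! j) 1))"
proof -
  interpret comm_ring_hom "\<lambda>f. eval_z f (coeff_vector (2 * c) g)"
    by (rule eval_z_hom)
  have "map_mat (\<lambda>f. eval_z f (coeff_vector (2 * c) g)) (A_matrix c) =
      multiplication_matrix c (\<lambda>j. poly (entries g ! j) 1)"
  proof (rule eq_matI)
    fix r k
    assume "r < dim_row (multiplication_matrix c (\<lambda>j. poly (entries g ! j) 1))"
      "k < dim_col (multiplication_matrix c (\<lambda>j. poly (entries g ! j) 1))"
    then have rk: "r < 3 * c" "k < 3 * c"
      by (simp_all add: multiplication_matrix_def)
    then have "k div c < 3"
      by (simp add: less_mult_imp_div_less)
    then show "map_mat (\<lambda>f. eval_z f (coeff_vector (2 * c) g)) (A_matrix c) $$ (r, k) =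
        multiplication_matrix c (\<lambda>j. poly (entries g ! j) 1) $$ (r, k)"
      using rk z_index_column[OF rk(2), of "r - k mod c"] A_matrix_carrier[of c, where ?'a = 'a]
        coeff_dehomogenization[OF entries_in_forms[OF g], of "k div c"]
      by (auto simp: A_matrix_index multiplication_matrix_def eval_z_zero eval_z_var coeff_vector_def)
  qed (use A_matrix_carrier[of c, where ?'a = 'a] in \<open>auto simp: multiplication_matrix_def\<close>)
  then show ?thesis
    using hom_det[of "A_matrix c"] by simp
qed

section \<open>Balanced triples\<close>

lemma entries_scalar_prod:
  assumes "v \<in> carrier_vec 3"
  shows "vec_of_list (entries g) \<bullet> v = (\<Sum>j<3. entries g ! j * v $ j)"
  using assms by (simp add: scalar_prod_def atLeast0LessThan vec_of_list_index)

lemma two_column_mult_vec: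
  assumes "\<phi> \<in> carrier_mat 3 2" "u \<in> carrier_vec 2" "j < 3"
  shows "(\<phi> *\<^sub>v u) $ j = \<phi> $$ (j, 0) * u $ 0 + \<phi> $$ (j, 1) * u $ 1"
  using assms by (simp add: scalar_prod_def numeral_2_eq_2)

text \<open>A kernel vector of the matrix is a nonzero syzygy of degree \<open>c - 1\<close>. It would be a combination of
  the columns of \<open>\<phi>\<close>, but these are forms of degree \<open>c\<close>, whose multiples have no component of
  degree \<open>c - 1\<close>.\<close>

lemma det_nonzero_if_Bal:
  fixes g :: "'a::field triple"
  assumes c: "c \<ge> 1" and Bal: "g \<in> Bal (2 * c)"
  shows "det (multiplication_matrix c (\<lambda>j. poly (entries g ! j) 1)) \<noteq> 0"
proof
  assume det: "det (multiplication_matrix c (\<lambda>j. poly (entries g ! j) 1)) = 0"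
  have g: "g \<in> triples (2 * c)"
    using Bal by (simp add: Bal_def)
  obtain \<phi> where \<phi>: "\<phi> \<in> carrier_mat 3 2" and deg: "\<And>j s. j < 3 \<Longrightarrow> s < 2 \<Longrightarrow> \<phi> $$ (j, s) \<in> forms c"
    and exact: "{v \<in> carrier_vec 3. vec_of_list (entries g) \<bullet> v = 0} = (\<lambda>u. \<phi> *\<^sub>v u) ` carrier_vec 2"
    using Bal by (auto simp: Bal_def hilbert_burch_exact_def)
  obtain Q where Q: "\<forall>j<3. degree (Q j) \<le> c - 1" "(\<Sum>j<3. poly (entries g ! j) 1 * Q j) = 0"
    and nz: "\<exists>j<3. Q j \<noteq> 0"
    using kernel_if_det_zero[OF c degree_dehomogenization[OF entries_in_forms[OF g]] det] by blast
  define q where "q j = binary_form (c - 1) (coeff (Q j))" for j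
  have q: "q j \<in> forms (c - 1)" for j
    by (simp add: q_def binary_form_in_forms)
  have q1: "poly (q j) 1 = Q j" if "j < 3" for j
    using Q(1) that by (simp add: q_def dehomogenization_homogenization)
  have "(\<Sum>j<3. entries g ! j * q j) = 0"
    using Q(2) q1 entries_in_forms[OF g] q
    by (intro form_eqI[of _ "2 * c + (c - 1)"] sum_in_forms mult_in_forms zero_in_forms) (auto simp: poly_sum)
  then have "vec 3 q \<in> {v \<in> carrier_vec 3. vec_of_list (entries g) \<bullet> v = 0}"
    by (simp add: entries_scalar_prod)
  then obtain u where u: "u \<in> carrier_vec 2" "vec 3 q = \<phi> *\<^sub>v u"
    unfolding exact by blast
  have "q j = 0" if j: "j < 3" for j
  proof -
    have "q j = \<phi> $$ (j, 0) * u $ 0 + \<phi> $$ (j, 1) * u $ 1"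
      using two_column_mult_vec[OF \<phi> u(1) j] u(2) j by (metis index_vec)
    then have "component (c - 1) (q j) =
        component (c - 1) (\<phi> $$ (j, 0) * u $ 0) + component (c - 1) (\<phi> $$ (j, 1) * u $ 1)"
      by (simp add: component_add)
    also have "\<dots> = 0"
      using c deg[OF j] by (simp add: component_form_mult_below[where n = c])
    finally show ?thesis
      using component_self[OF q] by simp
  qed
  then have "Q j = 0" if "j < 3" for j
    using q1[OF that] that by simp
  then show False
    using nz by blast
qed

text \<open>The bijectivity supplies the height through its surjective half and the matrix \<open>\<phi>\<close> through the
  two generators of the syzygy module, written as columns.\<close>

lemma Bal_if_det_nonzero:
  fixes g :: "'a::field triple"
  assumes c: "c \<ge> 1" and g: "g \<in> triples (2 * c)"
    and det: "det (multiplication_matrix c (\<lambda>j. poly (entries g ! j) 1)) \<noteq> 0"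
  shows "g \<in> Bal (2 * c)"
proof -
  have forms: "\<And>j. j < 3 \<Longrightarrow> entries g ! j \<in> forms (2 * c)"
    using g by (rule entries_in_forms)
  have bij: "bijective_multiplication c (\<lambda>j. poly (entries g ! j) 1)"
    using c degree_dehomogenization[OF forms] det by (rule bijective_if_det_nonzero)
  then interpret bijective_multiplication c "\<lambda>j. poly (entries g ! j) 1" .

  have all_forms: "F \<in> triple_ideal g" if F: "F \<in> forms (3 * c - 1)" for F
  proof -
    obtain Q where Q: "\<forall>j<3. degree (Q j) \<le> c - 1" "(\<Sum>j<3. poly (entries g ! j) 1 * Q j) = poly F 1"
      using surj[OF degree_dehomogenization[OF F]] by blast
    define q where "q j = binary_form (c - 1) (coeff (Q j))" for j
    have "poly (q j) 1 = Q j" if "j < 3" for j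
      using Q(1) that by (simp add: q_def dehomogenization_homogenization)
    moreover have "(\<Sum>j<3. entries g ! j * q j) \<in> forms (2 * c + (c - 1))"
      using forms by (intro sum_in_forms mult_in_forms) (auto simp: q_def binary_form_in_forms)
    moreover have "2 * c + (c - 1) = 3 * c - 1"
      using c by simp
    ultimately have "(\<Sum>j<3. entries g ! j * q j) = F"
      using Q(2) F by (intro form_eqI[of _ "3 * c - 1"]) (simp_all add: poly_sum)
    then show ?thesis
      using sum_mult_in_triple_ideal[of g q] by simp
  qed
  have power_form: "f ^ n \<in> forms n" if "f \<in> forms 1" for f :: "'a poly poly" and n
  proof (induction n)
    case 0
    show ?case
      by (auto simp: forms_def coeff_xy_def one_pCons coeff_pCons split: nat.splits)
  next
    case (Suc n)
    then show ?case
      using mult_in_forms[OF that Suc.IH] by simp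
  qed
  have height: "ideal_height class_ring (triple_ideal g) = 2"
  proof (rule ideal_height_eq_two)
    show "[:[:0, 1:]:] ^ (3 * c - 1) \<in> triple_ideal g" "[:0, 1:] ^ (3 * c - 1) \<in> triple_ideal g"
      by (intro all_forms power_form; auto simp: forms_def coeff_xy_def coeff_pCons split: nat.splits)+
    have origin: "ideal {f :: 'a poly poly. coeff_xy f 0 0 = 0} class_ring"
      by (auto simp: ideal_class_ring_iff coeff_xy_mult)
    have "coeff_xy (entries g ! j) 0 0 = 0" if "j < 3" for j
    proof (rule ccontr)
      assume "coeff_xy (entries g ! j) 0 0 \<noteq> 0"
      then have "0 + 0 = 2 * c"
        using forms[OF that] unfolding forms_def by blast
      then show False
        using c by simp
    qed
    moreover have "length (entries g) = 3"
      by (cases g) simp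
    ultimately have "set (entries g) \<subseteq> {f. coeff_xy f 0 0 = 0}"
      by (auto simp: in_set_conv_nth)
    with origin show "triple_ideal g \<subseteq> {f. coeff_xy f 0 0 = 0}"
      unfolding triple_ideal_def by (rule ring.genideal_minimal[OF class_ring.ring_axioms])
  qed

  \<comment> \<open>Otherwise \<open>(1, 0, 0)\<close> would be a syzygy, against injectivity.\<close>
  have g0: "entries g ! 0 \<noteq> 0"
  proof
    assume "entries g ! 0 = 0"
    then have "(\<Sum>j<3. poly (entries g ! j) 1 * (if j = 0 then 1 else 0)) = 0"
      by (simp add: numeral_3_eq_3)
    then have "(if (0::nat) = 0 then 1 else 0) = (0 :: 'a poly)"
      by (intro inj[of "\<lambda>j. if j = 0 then 1 else 0" 0]) auto
    then show False
      by simp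
  qed
  obtain p r where p: "\<forall>j<3. p j \<in> forms c" and r: "\<forall>j<3. r j \<in> forms c"
    and gp: "(\<Sum>j<3. entries g ! j * p j) = 0" and gr: "(\<Sum>j<3. entries g ! j * r j) = 0"
    and gen: "\<forall>v. (\<Sum>j<3. entries g ! j * v j) = 0 \<longrightarrow> (\<exists>a b. \<forall>j<3. v j = p j * a + r j * b)"
    using forms bij by (rule two_generators_of_syzygy_module)
  define \<phi> where "\<phi> = mat 3 2 (\<lambda>(j, s). if s = 0 then p j else r j)"
  have \<phi>: "\<phi> \<in> carrier_mat 3 2"
    by (simp add: \<phi>_def)
  have mult: "(\<phi> *\<^sub>v u) $ j = p j * u $ 0 + r j * u $ 1" if "u \<in> carrier_vec 2" "j < 3" for u j
    using two_column_mult_vec[OF \<phi> that] that by (simp add: \<phi>_def)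
  have "hilbert_burch_exact g \<phi>"
    unfolding hilbert_burch_exact_def
  proof (intro conjI ballI impI)
    fix u assume u: "u \<in> carrier_vec 2" and zero: "\<phi> *\<^sub>v u = 0\<^sub>v 3"
    have "p j * u $ 0 + r j * u $ 1 = 0" if "j < 3" for j
      using mult[OF u that] zero that by simp
    then have "u $ 0 = 0 \<and> u $ 1 = 0"
      by (rule generators_independent[OF gen g0])
    then show "u = 0\<^sub>v 2"
      using u by (intro eq_vecI) (auto simp: less_2_cases_iff)
  next
    show "{v \<in> carrier_vec 3. vec_of_list (entries g) \<bullet> v = 0} = (\<lambda>u. \<phi> *\<^sub>v u) ` carrier_vec 2"
    proof (intro equalityI subsetI)
      fix v assume "v \<in> {v \<in> carrier_vec 3. vec_of_list (entries g) \<bullet> v = 0}"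
      then have v: "v \<in> carrier_vec 3" "(\<Sum>j<3. entries g ! j * v $ j) = 0"
        by (auto simp: entries_scalar_prod)
      then obtain a b where ab: "\<forall>j<3. v $ j = p j * a + r j * b"
        using gen[rule_format, of "\<lambda>j. v $ j"] by blast
      define u where "u = vec 2 (\<lambda>s. if s = 0 then a else b)"
      have u: "u \<in> carrier_vec 2"
        by (simp add: u_def)
      have "v = \<phi> *\<^sub>v u"
        using v(1) \<phi> ab mult[OF u] by (intro eq_vecI) (auto simp: u_def)
      then show "v \<in> (\<lambda>u. \<phi> *\<^sub>v u) ` carrier_vec 2"
        using u by blast
    next
      fix v assume "v \<in> (\<lambda>u. \<phi> *\<^sub>v u) ` carrier_vec 2"
      then obtain u where u: "u \<in> carrier_vec 2" and v: "v = \<phi> *\<^sub>v u"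
        by blast
      have "(\<Sum>j<3. entries g ! j * (\<phi> *\<^sub>v u) $ j) =
          (\<Sum>j<3. entries g ! j * p j * u $ 0 + entries g ! j * r j * u $ 1)"
        using mult[OF u] by (intro sum.cong) (auto simp: distrib_left mult.assoc)
      also have "\<dots> = (\<Sum>j<3. entries g ! j * p j) * u $ 0 + (\<Sum>j<3. entries g ! j * r j) * u $ 1"
        by (simp add: sum.distrib sum_distrib_right)
      also have "\<dots> = 0"
        using gp gr by simp
      finally show "v \<in> {v \<in> carrier_vec 3. vec_of_list (entries g) \<bullet> v = 0}"
        using v u \<phi> by (simp add: entries_scalar_prod)
    qed
  qed
  moreover have "\<forall>j<3. \<forall>s<2. \<phi> $$ (j, s) \<in> forms (2 * c div 2)"
    using p r by (simp add: \<phi>_def)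
  ultimately show ?thesis
    using g height \<phi> by (auto simp: Bal_def)
qed

theorem theorem5p24:
  fixes c d :: nat and w :: "'a::field z_poly"
  assumes "c \<ge> 1" and "d = 2 * c"
    and "w = det (A_matrix c)"
  shows "w \<in> z_polys d \<and>
    triples d - Bal d = {g \<in> triples d. coeff_vector d g \<in> zero_locus d {w}} \<and>
    closed_in_triples d (triples d - Bal d :: 'a triple set)"
proof -
  have w: "w \<in> z_polys d"
    using assms det_A_matrix_in_z_polys by simp
  have "coeff_vector d g \<in> zero_locus d {w} \<longleftrightarrow> g \<notin> Bal d" if g: "g \<in> triples d" for g :: "'a triple"
  proof -
    have "coeff_vector d g \<in> affine_space d"
      by (simp add: coeff_vector_def affine_space_def)
    then have "coeff_vector d g \<in> zero_locus d {w} \<longleftrightarrow> eval_z w (coeff_vector d g) = 0"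
      by (simp add: zero_locus_def)
    also have "\<dots> \<longleftrightarrow> g \<notin> Bal d"
      using eval_det_A_matrix[of g c] det_nonzero_if_Bal[of c g] Bal_if_det_nonzero[of c g] g assms by auto
    finally show ?thesis .
  qed
  then have eq: "triples d - Bal d = {g \<in> triples d. coeff_vector d g \<in> zero_locus d {w}}"
    by auto
  moreover have "closed_in_triples d (triples d - Bal d :: 'a triple set)"
    unfolding closed_in_triples_def using w eq by blast
  ultimately show ?thesis
    using w by blast
qed

end
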